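(* In the setting described in the context, assume that $P$ satisfies conditions (a1) ($W$ and $X$ are $P$-conditionally independent given $\Theta$) and (a2) ($\Theta$ and $X$ are $P$-independent). Then the aggregate process $S$ is a $P$-CMPP$(\Theta,P_{X_1})$ if and only if there exists a $P_\Theta$-null set $C_*\in\mathfrak B(\Upsilon)$ such that for every $\theta\notin C_*$ the family $S$ is a $P_\theta$-CPP$(\theta,(P_\theta)_{X_1})$.
   Context: $\Upsilon:=(0,\infty)$ with Borel $\sigma$-algebra $\mathfrak B(\Upsilon)$. $(\Omega,\Sigma,P)$ is a probability space and $\Theta$ a real random variable on it with $P(\Theta\in(0,\infty))=1$; its law $P_\Theta$ is regarded as a measure on $\mathfrak B(\Upsilon)$. For a measure $R$ and random variable $Z$, $R_Z$ is the law of $Z$ under $R$. $N=\{N_t\}_{t\ge0}$ is a counting process: $N_0=0$, its paths are non-decreasing, right-continuous, integer valued, with jumps of size one, and tend to infinity as $t\to\infty$ (the exceptional null set and the explosion event $\{\sup_nT_n<\infty\}$ are assumed empty). Its arrival times are $T_0=0$, $T_n=\inf\{t:N_t=n\}$ and its interarrival process is $W=\{W_n\}_{n\ge1}$, $W_n=T_n-T_{n-1}$. $X=\{X_n\}_{n\ge1}$ (size process) is a sequence of positive random variables. The aggregate process is $S=\{S_t\}_{t\ge0}$, $S_t=\sum_{k=1}^{N_t}X_k$. $\{P_\theta\}_{\theta\in\Upsilon}$ is an (assumed existing) regular conditional probability of $P$ over $P_\Theta$ consistent with $\Theta$: each $P_\theta$ is a probability measure on $\Sigma$; $\theta\mapsto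 P_\theta(D)$ is $\mathfrak B(\Upsilon)$-measurable and $\int P_\theta(D)P_\Theta(d\theta)=P(D)$ for each $D\in\Sigma$; and for each $B\in\mathfrak B(\Upsilon)$, $P_\theta(\Theta^{-1}(B))=1$ for $P_\Theta$-a.a. $\theta\in B$. For a probability measure $R$ on $\Sigma$: $(N,X)$ is an $R$-risk process if $N$ is a counting process, $X$ is $R$-i.i.d., and $N$ and $X$ are $R$-independent. $N$ is a $P$-mixed Poisson process with parameter $\Theta$ if it has stationary independent increments conditionally given $\Theta$ and, for each $t>0$, the conditional law of $N_t$ given $\Theta$ is Poisson with mean $t\Theta$, $P$-a.s. $S$ is a $P$-CMPP$(\Theta,P_{X_1})$ if $(N,X)$ is a $P$-risk process and $N$ is a $P$-mixed Poisson process with parameter $\Theta$. $S$ is an $R$-CPP$(\lambda,R_{X_1})$, $\lambda>0$, if $(N,X)$ is an $R$-risk process and $N$ is an $R$-Poisson process with rate $\lambda$. *)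

theory Defs
  imports "HOL-Probability.Probability"
begin

section \<open>Generated sigma-algebras and conditional independence\<close>

definition gen_algebra :: "'a measure \<Rightarrow> 'b measure \<Rightarrow> ('a \<Rightarrow> 'b) \<Rightarrow> 'a measure" where
  "gen_algebra M L Z = vimage_algebra (space M) Z L"

text \<open>A process is regarded as a random element of the product space. The product sigma-algebra is
  generated by the coordinates, so this is the sigma-algebra generated by the single variables.\<close>
definition process_algebra ::
    "'a measure \<Rightarrow> 'i set \<Rightarrow> 'b measure \<Rightarrow> ('i \<Rightarrow> 'a \<Rightarrow> 'b) \<Rightarrow> 'a measure" where
  "process_algebra M I L Y = gen_algebra M (PiM I (\<lambda>_. L)) (\<lambda>\<omega>. \<lambda>i\<in>I. Y i \<omega>)"

definition cprob :: "'a measure \<Rightarrow> 'a measure \<Rightarrow> 'a set \<Rightarrow> 'a \<Rightarrow> real" where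
  "cprob M F A = real_cond_exp M F (indicator A)"

text \<open>Conditional analogues of \<^const>\<open>prob_space.indep_sets\<close> and \<^const>\<open>prob_space.indep_set\<close>,
  given the sub-sigma-algebra F.\<close>
definition cond_indep_sets ::
    "'a measure \<Rightarrow> 'a measure \<Rightarrow> ('i \<Rightarrow> 'a set set) \<Rightarrow> 'i set \<Rightarrow> bool" where
  "cond_indep_sets M F G I \<longleftrightarrow> (\<forall>i\<in>I. G i \<subseteq> sets M) \<and>
     (\<forall>J\<subseteq>I. J \<noteq> {} \<longrightarrow> finite J \<longrightarrow> (\<forall>A\<in>Pi J G.
        AE \<omega> in M. cprob M F (\<Inter>j\<in>J. A j) \<omega> = (\<Prod>j\<in>J. cprob M F (A j) \<omega>)))"

definition cond_indep_set :: "'a measure \<Rightarrow> 'a measure \<Rightarrow> 'a set set \<Rightarrow> 'a set set \<Rightarrow> bool" where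
  "cond_indep_set M F A B \<longleftrightarrow> cond_indep_sets M F (case_bool A B) UNIV"


section \<open>The mixing law and regular conditional probabilities\<close>

text \<open>The law of \<open>\<Theta>\<close>, regarded as a measure on the Borel sigma-algebra of \<open>(0, \<infinity>)\<close>.\<close>
definition law_pos :: "'a measure \<Rightarrow> ('a \<Rightarrow> real) \<Rightarrow> real measure" where
  "law_pos M \<Theta> = restrict_space (distr M borel \<Theta>) {0<..}"

definition regular_cond_prob :: "'a measure \<Rightarrow> ('a \<Rightarrow> real) \<Rightarrow> (real \<Rightarrow> 'a measure) \<Rightarrow> bool" where
  "regular_cond_prob M \<Theta> Q \<longleftrightarrow>
     (\<forall>\<theta>>0. prob_space (Q \<theta>) \<and> sets (Q \<theta>) = sets M) \<and>
     (\<forall>D\<in>sets M. (\<lambda>\<theta>. emeasure (Q \<theta>) D) \<in> borel_measurable (restrict_space borel {0<..}) \<and>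
        (\<integral>\<^sup>+\<theta>. emeasure (Q \<theta>) D \<partial>law_pos M \<Theta>) = emeasure M D) \<and>
     (\<forall>B\<in>sets (restrict_space borel {0<..}).
        AE \<theta> in law_pos M \<Theta>. \<theta> \<in> B \<longrightarrow> emeasure (Q \<theta>) (\<Theta> -` B \<inter> space M) = 1)"


section \<open>Counting, size and aggregate processes\<close>

text \<open>Only times \<open>t \<ge> 0\<close> and claim indices \<open>n \<ge> 1\<close> are relevant below. The path properties hold for
  every \<open>\<omega>\<close>, not just almost surely. As paths are everywhere finite, they cannot explode.\<close>

definition counting_process :: "'a measure \<Rightarrow> (real \<Rightarrow> 'a \<Rightarrow> nat) \<Rightarrow> bool" where
  "counting_process M N \<longleftrightarrow>
     (\<forall>t\<ge>0. N t \<in> M \<rightarrow>\<^sub>M count_space UNIV) \<and>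
     (\<forall>\<omega>\<in>space M.
        N 0 \<omega> = 0 \<and>
        mono_on {0..} (\<lambda>t. N t \<omega>) \<and>
        (\<forall>t\<ge>0. continuous (at_right t) (\<lambda>s. real (N s \<omega>))) \<and>
        (\<forall>t>0. real (N t \<omega>) - Lim (at_left t) (\<lambda>s. real (N s \<omega>)) \<in> {0, 1}) \<and>
        filterlim (\<lambda>t. N t \<omega>) at_top at_top)"

definition arrival :: "(real \<Rightarrow> 'a \<Rightarrow> nat) \<Rightarrow> nat \<Rightarrow> 'a \<Rightarrow> real" where
  "arrival N n \<omega> = (if n = 0 then 0 else Inf {t. t \<ge> 0 \<and> N t \<omega> = n})"

definition interarrival :: "(real \<Rightarrow> 'a \<Rightarrow> nat) \<Rightarrow> nat \<Rightarrow> 'a \<Rightarrow> real" where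
  "interarrival N n \<omega> = arrival N n \<omega> - arrival N (n - 1) \<omega>"

definition size_process :: "'a measure \<Rightarrow> (nat \<Rightarrow> 'a \<Rightarrow> real) \<Rightarrow> bool" where
  "size_process M X \<longleftrightarrow> (\<forall>n\<ge>1. X n \<in> borel_measurable M \<and> (\<forall>\<omega>\<in>space M. 0 < X n \<omega>))"

definition aggregate ::
    "(real \<Rightarrow> 'a \<Rightarrow> nat) \<Rightarrow> (nat \<Rightarrow> 'a \<Rightarrow> real) \<Rightarrow> real \<Rightarrow> 'a \<Rightarrow> real" where
  "aggregate N X t \<omega> = (\<Sum>k=1..N t \<omega>. X k \<omega>)"

definition iid_process :: "'a measure \<Rightarrow> (nat \<Rightarrow> 'a \<Rightarrow> real) \<Rightarrow> bool" where
  "iid_process R X \<longleftrightarrow> prob_space.indep_vars R (\<lambda>_. borel) X {1..} \<and>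
     (\<forall>n\<ge>1. distr R borel (X n) = distr R borel (X 1))"

definition risk_process ::
    "'a measure \<Rightarrow> (real \<Rightarrow> 'a \<Rightarrow> nat) \<Rightarrow> (nat \<Rightarrow> 'a \<Rightarrow> real) \<Rightarrow> bool" where
  "risk_process R N X \<longleftrightarrow> prob_space R \<and> counting_process R N \<and> size_process R X \<and>
     iid_process R X \<and>
     prob_space.indep_set R (sets (process_algebra R {0..} (count_space UNIV) N))
       (sets (process_algebra R {1..} borel X))"


section \<open>Poisson and mixed Poisson processes\<close>

text \<open>Paths are non-decreasing, so natural number subtraction is exact in the increments below.\<close>

definition poisson_process :: "'a measure \<Rightarrow> real \<Rightarrow> (real \<Rightarrow> 'a \<Rightarrow> nat) \<Rightarrow> bool" where
  "poisson_process R r N \<longleftrightarrow> counting_process R N \<and>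
     (\<forall>n (t :: nat \<Rightarrow> real). 0 \<le> t 0 \<longrightarrow> (\<forall>k<n. t k < t (Suc k)) \<longrightarrow>
        prob_space.indep_vars R (\<lambda>_. count_space UNIV) (\<lambda>k \<omega>. N (t (Suc k)) \<omega> - N (t k) \<omega>) {..<n}) \<and>
     (\<forall>s t h. 0 \<le> s \<longrightarrow> s \<le> t \<longrightarrow> 0 \<le> h \<longrightarrow>
        distr R (count_space UNIV) (\<lambda>\<omega>. N (t + h) \<omega> - N (s + h) \<omega>) =
        distr R (count_space UNIV) (\<lambda>\<omega>. N t \<omega> - N s \<omega>)) \<and>
     (\<forall>t>0. distr R (count_space UNIV) (N t) = measure_pmf (poisson_pmf (t * r)))"

text \<open>The same with conditional laws and conditional independence given \<open>\<sigma>(\<Theta>)\<close>; as the state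
  space is discrete, almost sure equality of conditional laws can be tested set by set.\<close>

definition mixed_poisson_process ::
    "'a measure \<Rightarrow> ('a \<Rightarrow> real) \<Rightarrow> (real \<Rightarrow> 'a \<Rightarrow> nat) \<Rightarrow> bool" where
  "mixed_poisson_process M \<Theta> N \<longleftrightarrow> counting_process M N \<and>
     (\<forall>n (t :: nat \<Rightarrow> real). 0 \<le> t 0 \<longrightarrow> (\<forall>k<n. t k < t (Suc k)) \<longrightarrow>
        cond_indep_sets M (gen_algebra M borel \<Theta>)
          (\<lambda>k. sets (gen_algebra M (count_space UNIV) (\<lambda>\<omega>. N (t (Suc k)) \<omega> - N (t k) \<omega>))) {..<n}) \<and>
     (\<forall>s t h B. 0 \<le> s \<longrightarrow> s \<le> t \<longrightarrow> 0 \<le> h \<longrightarrow>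
        (AE \<omega> in M.
           cprob M (gen_algebra M borel \<Theta>) {\<omega>\<in>space M. N (t + h) \<omega> - N (s + h) \<omega> \<in> B} \<omega> =
           cprob M (gen_algebra M borel \<Theta>) {\<omega>\<in>space M. N t \<omega> - N s \<omega> \<in> B} \<omega>)) \<and>
     (\<forall>t>0. \<forall>B. AE \<omega> in M.
        cprob M (gen_algebra M borel \<Theta>) {\<omega>\<in>space M. N t \<omega> \<in> B} \<omega> =
        measure_pmf.prob (poisson_pmf (t * \<Theta> \<omega>)) B)"


section \<open>Compound processes\<close>

text \<open>The measure K is the claim size distribution.\<close>

definition CPP :: "'a measure \<Rightarrow> (real \<Rightarrow> 'a \<Rightarrow> nat) \<Rightarrow> (nat \<Rightarrow> 'a \<Rightarrow> real) \<Rightarrow>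
    (real \<Rightarrow> 'a \<Rightarrow> real) \<Rightarrow> real \<Rightarrow> real measure \<Rightarrow> bool" where
  "CPP R N X S r K \<longleftrightarrow> (\<forall>t\<ge>0. \<forall>\<omega>\<in>space R. S t \<omega> = aggregate N X t \<omega>) \<and>
     risk_process R N X \<and> K = distr R borel (X 1) \<and> 0 < r \<and> poisson_process R r N"

definition CMPP :: "'a measure \<Rightarrow> (real \<Rightarrow> 'a \<Rightarrow> nat) \<Rightarrow> (nat \<Rightarrow> 'a \<Rightarrow> real) \<Rightarrow>
    (real \<Rightarrow> 'a \<Rightarrow> real) \<Rightarrow> ('a \<Rightarrow> real) \<Rightarrow> real measure \<Rightarrow> bool" where
  "CMPP M N X S \<Theta> K \<longleftrightarrow> (\<forall>t\<ge>0. \<forall>\<omega>\<in>space M. S t \<omega> = aggregate N X t \<omega>) \<and>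
     risk_process M N X \<and> K = distr M borel (X 1) \<and> mixed_poisson_process M \<Theta> N"

end

theory Submission
  imports Defs
begin

text \<open>By consistency of the disintegration, the conditional probability of an event \<open>D\<close> given \<open>\<Theta>\<close> is
  \<open>P\<^bsub>\<Theta>\<^esub>(D)\<close> almost surely, so an almost sure identity between conditional probabilities is an
  identity between the \<open>P\<^bsub>\<theta>\<^esub>\<close> for almost all \<open>\<theta>\<close>. Each property that involves uncountably many
  such identities is reduced to countably many. For the laws of \<open>X\<close> and of the interarrival
  times these are the identities on a countable intersection-stable generator; since \<open>\<sigma>(N)\<close> is
  contained in \<open>\<sigma>(W)\<close>, independence of \<open>W\<close> and \<open>X\<close> suffices. For the Poisson property these are
  the point probabilities of increments over rational times, and right-continuity of the paths
  covers the other times. Conditions (a1) and (a2) alone give that under almost every \<open>P\<^bsub>\<theta>\<^esub>\<close> the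
  sequence \<open>X\<close> has the same law as under \<open>P\<close> and is independent of \<open>N\<close>; averaging over \<open>\<theta>\<close>, \<open>N\<close> and
  \<open>X\<close> are \<open>P\<close>-independent as well. Hence the two risk process conditions are equivalent, and only
  the (mixed) Poisson property remains to be compared.\<close>

section \<open>Generated sigma-algebras\<close>

lemma space_gen_algebra [simp]: "space (gen_algebra M L Z) = space M"
  by (simp add: gen_algebra_def)

lemma space_process_algebra [simp]: "space (process_algebra M I L Y) = space M"
  by (simp add: process_algebra_def)

lemma process_algebra_cong:
  "space M = space M' \<Longrightarrow> process_algebra M I L Y = process_algebra M' I L Y"
  by (simp add: process_algebra_def gen_algebra_def)

lemma sets_gen_algebra_subset:
  assumes "Z \<in> M' \<rightarrow>\<^sub>M L" "space M' = space M"
  shows "sets (gen_algebra M L Z) \<subseteq> sets M'"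
  unfolding gen_algebra_def using assms by (intro sets_image_in_sets) auto

lemma sets_gen_algebra:
  assumes "Z \<in> space M \<rightarrow> space L"
  shows "sets (gen_algebra M L Z) = {Z -` A \<inter> space M | A. A \<in> sets L}"
  unfolding gen_algebra_def using assms by (rule sets_vimage_algebra2)

lemma subalgebra_gen_algebra: "Z \<in> M \<rightarrow>\<^sub>M L \<Longrightarrow> subalgebra M (gen_algebra M L Z)"
  using sets_gen_algebra_subset[of Z M L M] by (auto simp: subalgebra_def)

lemma sets_process_algebra_subset:
  assumes "\<And>i. i \<in> I \<Longrightarrow> Y i \<in> M' \<rightarrow>\<^sub>M L" "space M' = space M"
  shows "sets (process_algebra M I L Y) \<subseteq> sets M'"
  unfolding process_algebra_def using assms
  by (intro sets_gen_algebra_subset measurable_restrict) auto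

lemma measurable_process_algebra:
  assumes "\<And>i. i \<in> I \<Longrightarrow> Y i \<in> space M \<rightarrow> space L" "i \<in> I"
  shows "Y i \<in> process_algebra M I L Y \<rightarrow>\<^sub>M L"
proof -
  have "(\<lambda>\<omega>. \<lambda>i\<in>I. Y i \<omega>) \<in> process_algebra M I L Y \<rightarrow>\<^sub>M PiM I (\<lambda>_. L)"
    unfolding process_algebra_def gen_algebra_def using assms(1)
    by (intro measurable_vimage_algebra1) (auto simp: space_PiM Pi_iff)
  from measurable_compose[OF this measurable_component_singleton[OF assms(2)]]
  show ?thesis using assms(2) by simp
qed

text \<open>Rational bounds leave only countably many cylinders over a countable index set.\<close>
definition cylinder :: "'a measure \<Rightarrow> ('i \<Rightarrow> 'a \<Rightarrow> real) \<Rightarrow> ('i \<times> rat) list \<Rightarrow> 'a set" where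
  "cylinder M Y ps = {\<omega>\<in>space M. \<forall>(i, q)\<in>set ps. Y i \<omega> \<le> of_rat q}"

text \<open>An index may recur in a list, so intersecting two cylinders amounts to imposing both
  lists of bounds.\<close>

lemma cylinder_Int: "cylinder M Y ps \<inter> cylinder M Y qs = cylinder M Y (ps @ qs)"
  by (auto simp: cylinder_def)

lemma Int_stable_cylinder: "Int_stable (cylinder M Y ` lists (I \<times> UNIV))"
proof (rule Int_stableI)
  fix a b assume "a \<in> cylinder M Y ` lists (I \<times> UNIV)" "b \<in> cylinder M Y ` lists (I \<times> UNIV)"
  then obtain ps qs where "ps \<in> lists (I \<times> UNIV)" "qs \<in> lists (I \<times> UNIV)"
    "a = cylinder M Y ps" "b = cylinder M Y qs" by auto
  then show "a \<inter> b \<in> cylinder M Y ` lists (I \<times> UNIV)"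
    by (auto simp: cylinder_Int intro!: imageI)
qed

lemma cylinder_subset: "cylinder M Y ps \<subseteq> space M"
  by (auto simp: cylinder_def)

lemma cylinder_in_sets:
  assumes "\<And>i. i \<in> I \<Longrightarrow> Y i \<in> borel_measurable M'" "ps \<in> lists (I \<times> UNIV)" "space M' = space M"
  shows "cylinder M Y ps \<in> sets M'"
proof -
  have "{\<omega>\<in>space M'. \<forall>x\<in>set ps. Y (fst x) \<omega> \<le> of_rat (snd x)} \<in> sets M'"
    using assms(1,2) by (intro sets.sets_Collect_finite_All) (auto intro!: borel_measurable_le)
  then show ?thesis
    using assms(3) by (simp add: cylinder_def case_prod_unfold)
qed

text \<open>One-bound cylinders suffice to make each coordinate measurable, because
  \<open>Y i \<omega> < y\<close> holds iff \<open>Y i \<omega> \<le> of_rat q\<close> for some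
  rational \<open>q\<close> below \<open>y\<close>. For countable \<open>I\<close> this is a
  countable intersection-stable generator, the tool for merging null sets later.\<close>

lemma sets_process_algebra_cylinder:
  "sets (process_algebra M I borel Y) = sigma_sets (space M) (cylinder M Y ` lists (I \<times> UNIV))"
proof
  let ?C = "cylinder M Y ` lists (I \<times> UNIV)"
  let ?S = "sigma (space M) ?C"
  have C: "?C \<subseteq> Pow (space M)" using cylinder_subset[of M Y] by auto
  have "Y i \<in> borel_measurable ?S" if i: "i \<in> I" for i
  proof (rule borel_measurableI_less)
    fix y
    have "{\<omega>\<in>space M. Y i \<omega> < y} = (\<Union>q\<in>{q. of_rat q < y}. cylinder M Y [(i, q)])"
    proof safe
      fix \<omega> assume "\<omega> \<in> space M" "Y i \<omega> < y"
      then obtain q where "Y i \<omega> < of_rat q" "of_rat q < y" using of_rat_dense by blast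
      then show "\<omega> \<in> (\<Union>q\<in>{q. of_rat q < y}. cylinder M Y [(i, q)])"
        using \<open>\<omega> \<in> space M\<close> by (auto simp: cylinder_def intro!: exI[of _ q])
    qed (auto simp: cylinder_def)
    also have "\<dots> \<in> sigma_sets (space M) ?C"
      using i by (intro sigma_sets_UNION) (auto intro!: sigma_sets.Basic)
    finally show "{\<omega>\<in>space ?S. Y i \<omega> < y} \<in> sets ?S" using C by simp
  qed
  then have "sets (process_algebra M I borel Y) \<subseteq> sets ?S"
    by (intro sets_process_algebra_subset) (use C in auto)
  then show "sets (process_algebra M I borel Y) \<subseteq> sigma_sets (space M) ?C"
    using C by simp
  have "?C \<subseteq> sets (process_algebra M I borel Y)"
    by (intro image_subsetI cylinder_in_sets measurable_process_algebra) auto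
  then show "sigma_sets (space M) ?C \<subseteq> sets (process_algebra M I borel Y)"
    using sets.sigma_sets_subset[of ?C "process_algebra M I borel Y"] by simp
qed

section \<open>Paths of counting processes\<close>

lemma counting_process_cong:
  assumes "sets M = sets M'"
  shows "counting_process M N = counting_process M' N"
proof -
  have "M \<rightarrow>\<^sub>M (count_space UNIV :: nat measure) = M' \<rightarrow>\<^sub>M count_space UNIV"
    using assms by (rule measurable_cong_sets) simp
  then show ?thesis
    by (simp only: counting_process_def sets_eq_imp_space_eq[OF assms])
qed

lemma size_process_cong:
  assumes "sets M = sets M'"
  shows "size_process M X = size_process M' X"
proof -
  have "borel_measurable M = (borel_measurable M' :: ('a \<Rightarrow> real) set)"
    using assms by (rule measurable_cong_sets) simp
  then show ?thesis
    by (simp only: size_process_def sets_eq_imp_space_eq[OF assms])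
qed

text \<open>Integers at distance less than 1 coincide, so right-continuity of an integer-valued path
  means that it is constant just after \<open>t\<close>.\<close>

lemma counting_process_eventually_eq:
  assumes "counting_process M N" "\<omega> \<in> space M" "0 \<le> t"
  shows "\<forall>\<^sub>F s in at_right t. N s \<omega> = N t \<omega>"
proof -
  have "((\<lambda>s. real (N s \<omega>)) \<longlongrightarrow> real (N t \<omega>)) (at_right t)"
    using assms by (auto simp: counting_process_def continuous_within)
  then have "\<forall>\<^sub>F s in at_right t. dist (real (N s \<omega>)) (real (N t \<omega>)) < 1"
    by (rule tendstoD) simp
  then show ?thesis by (rule eventually_mono) (auto simp: dist_real_def)
qed

text \<open>No level is skipped. The witness is the infimum of the times at which the path is at
  least \<open>n\<close>: right-continuity puts the path at \<open>n\<close> or above there, and as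
  it was below \<open>n\<close> before, a jump of at most one cannot carry it beyond
  \<open>n\<close>.\<close>

lemma counting_process_attains:
  assumes "counting_process M N" "\<omega> \<in> space M" and t: "0 \<le> t" "n \<le> N t \<omega>"
  obtains u where "0 \<le> u" "u \<le> t" "N u \<omega> = n" "\<And>s. 0 \<le> s \<Longrightarrow> n \<le> N s \<omega> \<Longrightarrow> u \<le> s"
proof -
  let ?A = "{s. 0 \<le> s \<and> n \<le> N s \<omega>}"
  define u where "u = Inf ?A"
  have mono: "\<And>r s. 0 \<le> r \<Longrightarrow> r \<le> s \<Longrightarrow> N r \<omega> \<le> N s \<omega>"
    using assms(1,2) by (auto simp: counting_process_def mono_on_def)
  have bdd: "bdd_below ?A" by (rule bdd_belowI[of _ 0]) auto
  have le: "u \<le> s" if "0 \<le> s" "n \<le> N s \<omega>" for s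
    unfolding u_def using that bdd by (intro cInf_lower) auto
  have u0: "0 \<le> u" unfolding u_def using t by (intro cInf_greatest) auto
  have ge: "n \<le> N u \<omega>"
  proof -
    have "\<forall>\<^sub>F s in at_right u. N s \<omega> = N u \<omega>"
      using assms(1,2) u0 by (rule counting_process_eventually_eq)
    then obtain b where b: "b > u" "\<And>s. u < s \<Longrightarrow> s < b \<Longrightarrow> N s \<omega> = N u \<omega>"
      unfolding eventually_at_right_field by blast
    \<comment> \<open>Members of \<open>?A\<close> come arbitrarily close to its infimum; one below
      \<open>b\<close> either is \<open>u\<close> or has the same value of the path as
      \<open>u\<close>.\<close>
    obtain s where s: "s \<in> ?A" "s < b"
      using cInf_lessD[of ?A b] b(1) t unfolding u_def by blast
    then show ?thesis using le[of s] b(2)[of s] by (cases "s = u") auto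
  qed
  have "N u \<omega> \<le> n"
  proof (cases "u = 0")
    case True
    then show ?thesis using assms(1,2) by (simp add: counting_process_def)
  next
    case False
    with u0 have u: "0 < u" by simp
    \<comment> \<open>The values before \<open>u\<close> are bounded by \<open>n\<close>, so a
      greatest one \<open>m\<close> is attained. By monotonicity the path stays at \<open>m\<close>
      from there up to \<open>u\<close>, which makes \<open>m\<close> the left limit.\<close>
    let ?P = "\<lambda>s. 0 < s \<and> s < u"
    have below: "\<forall>s. ?P s \<longrightarrow> N s \<omega> < n"
      proof (intro allI impI)
      fix s assume "0 < s \<and> s < u"
      then show "N s \<omega> < n" using le[of s] by linarith
    qed
    have "?P (u/2)" using u by simp
    then obtain s where s: "0 < s" "s < u" "\<And>r. ?P r \<Longrightarrow> N r \<omega> \<le> N s \<omega>"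
      using ex_has_greatest_nat[of ?P "u/2" "\<lambda>s. N s \<omega>" n] below by blast
    define m where "m = N s \<omega>"
    have "\<forall>\<^sub>F r in at_left u. real (N r \<omega>) = real m"
      unfolding eventually_at_left_field
    proof (intro exI conjI allI impI)
      fix r assume "s < r" "r < u"
      then show "real (N r \<omega>) = real m"
        using s(3)[of r] mono[of s r] s(1) by (auto simp: m_def)
    qed (use s in auto)
    then have "((\<lambda>r. real (N r \<omega>)) \<longlongrightarrow> real m) (at_left u)"
      by (rule tendsto_eventually)
    then have "Lim (at_left u) (\<lambda>r. real (N r \<omega>)) = real m"
      by (intro tendsto_Lim) auto
    moreover have "real (N u \<omega>) - Lim (at_left u) (\<lambda>r. real (N r \<omega>)) \<in> {0, 1}"
      using assms(1,2) u by (auto simp: counting_process_def)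
    ultimately show ?thesis using below s by (auto simp: m_def)
  qed
  with ge have "N u \<omega> = n" by simp
  with u0 le[OF t] show thesis by (rule that) (rule le)
qed

text \<open>The path tends to infinity and skips no level, so for \<open>n > 0\<close> the infimum
  in \<open>arrival\<close> is a minimum, and it is also the first time at which the path is at
  least \<open>n\<close>.\<close>

lemma arrival_le_iff:
  assumes "counting_process M N" "\<omega> \<in> space M" "0 \<le> t"
  shows "arrival N n \<omega> \<le> t \<longleftrightarrow> n \<le> N t \<omega>"
proof (cases "n = 0")
  case True
  then show ?thesis using assms by (simp add: arrival_def)
next
  case False
  have "filterlim (\<lambda>t. N t \<omega>) at_top at_top"
    using assms by (auto simp: counting_process_def)
  then have "\<forall>\<^sub>F s in at_top. n \<le> N s \<omega> \<and> 0 \<le> s"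
    using eventually_ge_at_top[of "0::real"] by (auto simp: filterlim_at_top eventually_conj_iff)
  then obtain s where s: "0 \<le> s" "n \<le> N s \<omega>"
    using eventually_happens[of _ "at_top :: real filter"] by auto
  obtain u where u: "0 \<le> u" "u \<le> s" "N u \<omega> = n" "\<And>s. 0 \<le> s \<Longrightarrow> n \<le> N s \<omega> \<Longrightarrow> u \<le> s"
    using counting_process_attains[OF assms(1,2) s] by blast
  have "arrival N n \<omega> = u"
    unfolding arrival_def using False u(1,3,4) by (auto intro!: cInf_eq_minimum)
  moreover have "N u \<omega> \<le> N t \<omega>" if "u \<le> t"
    using assms u(1) that by (auto simp: counting_process_def mono_on_def)
  ultimately show ?thesis using u(3) u(4)[of t] assms(3) by auto
qed

lemma arrival_eq_sum_interarrival: "arrival N n \<omega> = (\<Sum>k=1..n. interarrival N k \<omega>)"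
proof -
  have "(\<Sum>k=1..n. interarrival N k \<omega>) = (\<Sum>k=1..n. arrival N k \<omega> - arrival N (k - 1) \<omega>)"
    by (simp add: interarrival_def)
  also have "\<dots> = arrival N n \<omega>"
    by (induction n) (simp_all add: arrival_def)
  finally show ?thesis by simp
qed

text \<open>The event \<open>n \<le> N t\<close> is \<open>arrival N n \<le> t\<close>, and arrival
  times are finite sums of interarrival times. Independence from the interarrival process is thereby
  inherited by \<open>N\<close>.\<close>

lemma sets_process_algebra_counting:
  assumes "counting_process M N"
  shows "sets (process_algebra M {0..} (count_space UNIV) N)
    \<subseteq> sets (process_algebra M {1..} borel (interarrival N))"
proof (rule sets_process_algebra_subset)
  let ?F = "process_algebra M {1..} borel (interarrival N)"
  fix t :: real assume t: "t \<in> {0..}"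
  have "(\<lambda>\<omega>. arrival N n \<omega>) \<in> borel_measurable ?F" for n
    unfolding arrival_eq_sum_interarrival
    by (intro borel_measurable_sum measurable_process_algebra) auto
  then have "{\<omega>\<in>space ?F. arrival N n \<omega> \<le> t} \<in> sets ?F" for n
    by (intro borel_measurable_le) auto
  moreover have "{\<omega>\<in>space ?F. arrival N n \<omega> \<le> t} = {\<omega>\<in>space M. n \<le> N t \<omega>}" for n
    using arrival_le_iff[OF assms, of _ t n] t by auto
  ultimately have *: "{\<omega>\<in>space M. n \<le> N t \<omega>} \<in> sets ?F" for n
    by (simp only:)
  have "N t -` {n} \<inter> space ?F = {\<omega>\<in>space M. n \<le> N t \<omega>} - {\<omega>\<in>space M. Suc n \<le> N t \<omega>}" for n
    by auto
  then have "N t -` {n} \<inter> space ?F \<in> sets ?F" for n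
    using sets.Diff[OF *[of n] *[of "Suc n"]] by simp
  then show "N t \<in> ?F \<rightarrow>\<^sub>M count_space UNIV"
    by (simp add: measurable_count_space_eq2_countable)
qed simp

section \<open>Disintegration of the probability measure\<close>

locale disintegration = prob_space M for M :: "'a measure" +
  fixes \<Theta> :: "'a \<Rightarrow> real" and Q :: "real \<Rightarrow> 'a measure"
  assumes measurable_Theta [measurable]: "\<Theta> \<in> borel_measurable M"
    and Theta_pos: "emeasure M {\<omega>\<in>space M. \<Theta> \<omega> \<in> {0<..}} = 1"
    and regular: "regular_cond_prob M \<Theta> Q"
begin

abbreviation "\<F> \<equiv> gen_algebra M borel \<Theta>"
abbreviation "\<mu> \<equiv> law_pos M \<Theta>"

lemma sets_law_pos: "sets \<mu> = sets (restrict_space borel {0<..})"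
  by (simp add: law_pos_def sets_restrict_space)

lemma space_law_pos [simp]: "space \<mu> = {0<..}"
  by (simp add: law_pos_def space_restrict_space)

lemma AE_Theta_pos: "AE \<omega> in M. 0 < \<Theta> \<omega>"
  using Theta_pos AE_in_set_eq_1[of "{\<omega>\<in>space M. \<Theta> \<omega> \<in> {0<..}}"]
  by (auto simp: emeasure_eq_measure)

lemma AE_law_posD:
  assumes "AE \<theta> in \<mu>. P \<theta>"
  shows "AE \<omega> in M. P (\<Theta> \<omega>)"
proof -
  have "AE \<theta> in distr M borel \<Theta>. \<theta> \<in> {0<..} \<longrightarrow> P \<theta>"
    using assms unfolding law_pos_def by (subst (asm) AE_restrict_space_iff) auto
  from AE_distrD[OF measurable_Theta this] AE_Theta_pos show ?thesis
    by eventually_elim auto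
qed

text \<open>A pushforward measure only sees Borel sets, so in this direction the set of good
  parameters has to be Borel. The implication absorbs the parameters outside the positive
  half-line.\<close>

lemma AE_law_posI:
  assumes "{\<theta>. 0 < \<theta> \<longrightarrow> P \<theta>} \<in> sets borel" "AE \<omega> in M. P (\<Theta> \<omega>)"
  shows "AE \<theta> in \<mu>. P \<theta>"
proof -
  have "AE \<theta> in distr M borel \<Theta>. 0 < \<theta> \<longrightarrow> P \<theta>"
    using assms by (subst AE_distr_iff) auto
  then show ?thesis
    unfolding law_pos_def by (subst AE_restrict_space_iff) auto
qed

lemma prob_space_law_pos: "prob_space \<mu>"
proof -
  have "emeasure \<mu> {0<..} = emeasure (distr M borel \<Theta>) {0<..}"
    unfolding law_pos_def by (rule emeasure_restrict_space) auto
  also have "\<dots> = emeasure M {\<omega>\<in>space M. \<Theta> \<omega> \<in> {0<..}}"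
    by (subst emeasure_distr) (auto intro!: arg_cong[of _ _ "emeasure M"])
  finally show ?thesis using Theta_pos by (auto intro!: prob_spaceI)
qed

text \<open>The mixing law has mass one, so an almost everywhere statement holds somewhere. This
  serves to extract conclusions that do not mention the parameter.\<close>

lemma law_pos_ex:
  assumes "AE \<theta> in \<mu>. P \<theta>"
  obtains \<theta> where "0 < \<theta>" "P \<theta>"
proof -
  have "AE \<theta> in \<mu>. 0 < \<theta>"
    by (rule AE_I2) simp
  with assms have "AE \<theta> in \<mu>. 0 < \<theta> \<and> P \<theta>" by eventually_elim auto
  moreover have "ae_filter \<mu> \<noteq> bot"
    using prob_space.ae_filter_bot[OF prob_space_law_pos] .
  ultimately show thesis using that eventually_happens by blast
qed

lemma
  assumes "0 < \<theta>"
  shows prob_space_Q: "prob_space (Q \<theta>)"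
    and sets_Q: "sets (Q \<theta>) = sets M"
    and space_Q: "space (Q \<theta>) = space M"
  using regular assms sets_eq_imp_space_eq[of "Q \<theta>" M] unfolding regular_cond_prob_def by auto

lemma emeasure_Q: "0 < \<theta> \<Longrightarrow> emeasure (Q \<theta>) D = ennreal (measure (Q \<theta>) D)"
  using prob_space_Q by (simp add: finite_measure.emeasure_eq_measure prob_space.finite_measure)

lemma measure_Q_bounded: "0 < \<theta> \<Longrightarrow> measure (Q \<theta>) D \<le> 1"
  by (rule prob_space.prob_le_1[OF prob_space_Q])

lemma measurable_Q:
  assumes "D \<in> sets M"
  shows "(\<lambda>\<theta>. measure (Q \<theta>) D) \<in> borel_measurable (restrict_space borel {0<..})"
proof -
  have "(\<lambda>\<theta>. enn2real (emeasure (Q \<theta>) D)) \<in> borel_measurable (restrict_space borel {0<..})"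
    using regular assms unfolding regular_cond_prob_def by (intro borel_measurable_enn2real) blast
  then show ?thesis by (simp add: measure_def)
qed

lemma measurable_Q_law_pos [measurable]:
  "D \<in> sets M \<Longrightarrow> (\<lambda>\<theta>. measure (Q \<theta>) D) \<in> borel_measurable \<mu>"
  using measurable_Q by (subst measurable_cong_sets[OF sets_law_pos refl])

text \<open>The indicator removes the values of \<open>Q \<theta>\<close> for \<open>\<theta> \<le> 0\<close>, which are unconstrained.\<close>
lemma measurable_indicator_Q:
  assumes "D \<in> sets M"
  shows "(\<lambda>\<theta>. indicator {0<..} \<theta> * measure (Q \<theta>) D) \<in> borel_measurable borel"
  using measurable_Q[OF assms]
  by (subst (asm) borel_measurable_restrict_space_iff) (auto simp: mult.commute)

lemma measure_eq_integral_Q: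
  assumes "D \<in> sets M"
  shows "measure M D = (\<integral>\<theta>. measure (Q \<theta>) D \<partial>\<mu>)"
proof -
  have "emeasure M D = (\<integral>\<^sup>+\<theta>. emeasure (Q \<theta>) D \<partial>\<mu>)"
    using regular assms unfolding regular_cond_prob_def by simp
  also have "\<dots> = (\<integral>\<^sup>+\<theta>. ennreal (measure (Q \<theta>) D) \<partial>\<mu>)"
    by (intro nn_integral_cong) (simp add: emeasure_Q)
  finally show ?thesis
    using assms by (subst integral_eq_nn_integral) (auto simp: measure_def[of M])
qed

lemma integral_law_pos:
  fixes f :: "real \<Rightarrow> real"
  assumes "(\<lambda>\<theta>. indicator {0<..} \<theta> * f \<theta>) \<in> borel_measurable borel"
  shows "(\<integral>\<theta>. f \<theta> \<partial>\<mu>) = (\<integral>\<omega>. indicator {0<..} (\<Theta> \<omega>) * f (\<Theta> \<omega>) \<partial>M)"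
proof -
  have "(\<integral>\<theta>. f \<theta> \<partial>\<mu>) = (\<integral>\<theta>. indicator {0<..} \<theta> * f \<theta> \<partial>distr M borel \<Theta>)"
    unfolding law_pos_def by (subst integral_restrict_space) auto
  also have "\<dots> = (\<integral>\<omega>. indicator {0<..} (\<Theta> \<omega>) * f (\<Theta> \<omega>) \<partial>M)"
    using assms by (subst integral_distr) auto
  finally show ?thesis .
qed

sublocale cond: sigma_finite_subalgebra M \<F>
  by (intro finite_measure_subalgebra_is_sigma_finite)
     (simp add: finite_measure_subalgebra_def finite_measure_subalgebra_axioms_def
       finite_measure_axioms subalgebra_gen_algebra)

lemma measurable_Theta_gen: "\<Theta> \<in> borel_measurable \<F>"
  unfolding gen_algebra_def by (rule measurable_vimage_algebra1) simp

text \<open>Under \<open>Q \<theta>\<close> the variable \<Theta> almost surely lies on the same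
  side of \<open>B\<close> as \<theta>. Consistency is used for \<open>B\<close> and for its
  complement, both cut down to the positive half-line.\<close>

lemma Q_consistent:
  assumes D: "D \<in> sets M" and B: "B \<in> sets borel"
  shows "AE \<theta> in \<mu>. measure (Q \<theta>) (D \<inter> (\<Theta> -` B \<inter> space M)) = indicator B \<theta> * measure (Q \<theta>) D"
proof -
  have consistent: "AE \<theta> in \<mu>. \<theta> \<in> A \<longrightarrow> emeasure (Q \<theta>) (\<Theta> -` A \<inter> space M) = 1"
    if "A \<in> sets (restrict_space borel {0<..})" for A
    using regular that unfolding regular_cond_prob_def by blast
  have pos: "AE \<theta> in \<mu>. 0 < \<theta>" by (rule AE_I2) simp
  have "B \<inter> {0<..} \<in> sets (restrict_space borel {0<..})" "- B \<inter> {0<..} \<in> sets (restrict_space borel {0<..})"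
    using B by (auto simp: sets_restrict_space)
  from consistent[OF this(1)] consistent[OF this(2)] pos show ?thesis
  proof eventually_elim
    case (elim \<theta>)
    interpret Q: prob_space "Q \<theta>" using elim(3) by (rule prob_space_Q)
    have in_Q: "\<Theta> -` A \<inter> space M \<in> sets (Q \<theta>)" if "A \<in> sets borel" for A
      using that by (simp add: sets_Q[OF elim(3)] measurable_sets[OF measurable_Theta])
    have D': "D \<in> sets (Q \<theta>)" using D by (simp add: sets_Q[OF elim(3)])
    show ?case
    proof (cases "\<theta> \<in> B")
      case True
      then have "AE \<omega> in Q \<theta>. \<omega> \<in> \<Theta> -` (B \<inter> {0<..}) \<inter> space M"
        using elim in_Q[of "B \<inter> {0<..}"] B by (intro Q.AE_prob_1) (auto simp: measure_def)
      then have "measure (Q \<theta>) (D \<inter> (\<Theta> -` B \<inter> space M)) = measure (Q \<theta>) D"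
        using in_Q[OF B] D' by (intro Q.finite_measure_eq_AE) auto
      then show ?thesis using True by simp
    next
      case False
      then have "AE \<omega> in Q \<theta>. \<omega> \<in> \<Theta> -` (- B \<inter> {0<..}) \<inter> space M"
        using elim in_Q[of "- B \<inter> {0<..}"] B by (intro Q.AE_prob_1) (auto simp: measure_def)
      then have "measure (Q \<theta>) (D \<inter> (\<Theta> -` B \<inter> space M)) = measure (Q \<theta>) {}"
        using in_Q[OF B] D' by (intro Q.finite_measure_eq_AE) auto
      then show ?thesis using False by simp
    qed
  qed
qed

text \<open>Conditional probabilities are characterised by their integrals over the events
  \<open>\<Theta> -\<close> B\<open>. Disintegrating\<close>D \<inter> \<Theta> -\<open>B\<close>
  and applying \<open>Q_consistent\<close> gives the integral of
  \<open>measure (Q \<theta>) D\<close> over \<open>B\<close>, which is then pulled back to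
  \<open>M\<close>.\<close>

lemma cprob_eq_Q:
  assumes D: "D \<in> sets M"
  shows "AE \<omega> in M. cprob M \<F> D \<omega> = measure (Q (\<Theta> \<omega>)) D"
proof -
  \<comment> \<open>Extension by zero makes the kernel Borel on the whole line, so that its
    composition with \<Theta> is measurable for the sigma-algebra of \<Theta>.\<close>
  define g where "g \<theta> = indicator {0<..} \<theta> * measure (Q \<theta>) D" for \<theta>
  have g [measurable]: "g \<in> borel_measurable borel"
    unfolding g_def using measurable_indicator_Q[OF D] .
  have g_bounded: "\<bar>g \<theta>\<bar> \<le> 1" for \<theta>
    using measure_Q_bounded[of \<theta> D] by (auto simp: g_def indicator_def)
  have "AE \<omega> in M. cprob M \<F> D \<omega> = g (\<Theta> \<omega>)"
    unfolding cprob_def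
  proof (rule cond.real_cond_exp_charact)
    fix A assume "A \<in> sets \<F>"
    then obtain B where B: "B \<in> sets borel" "A = \<Theta> -` B \<inter> space M"
      using sets_gen_algebra[of \<Theta> M borel] by auto
    have A: "A \<in> sets M" using B by simp
    have "(\<integral>\<omega>\<in>A. indicat_real D \<omega> \<partial>M) = measure M (D \<inter> A)"
    proof -
      have "(\<integral>\<omega>\<in>A. indicat_real D \<omega> \<partial>M) = (\<integral>\<omega>. indicat_real (D \<inter> A) \<omega> \<partial>M)"
        unfolding set_lebesgue_integral_def
        by (intro Bochner_Integration.integral_cong) (auto simp: indicator_def)
      then show ?thesis using A D by simp
    qed
    also have "\<dots> = (\<integral>\<theta>. measure (Q \<theta>) (D \<inter> A) \<partial>\<mu>)"
      using A D by (intro measure_eq_integral_Q) auto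
    also have "\<dots> = (\<integral>\<theta>. indicator B \<theta> * measure (Q \<theta>) D \<partial>\<mu>)"
    proof (rule integral_cong_AE)
      \<comment> \<open>\<open>B\<close> may reach outside the space of \<mu>, so measurability is
        shown for its trace first.\<close>
      have "B \<inter> {0<..} \<in> sets \<mu>" using B by (auto simp: sets_law_pos sets_restrict_space)
      then have "(\<lambda>\<theta>. indicator (B \<inter> {0<..}) \<theta> * measure (Q \<theta>) D) \<in> borel_measurable \<mu>"
        using D by measurable
      then show "(\<lambda>\<theta>. indicator B \<theta> * measure (Q \<theta>) D) \<in> borel_measurable \<mu>"
        by (rule measurable_cong[THEN iffD1, rotated]) (simp add: indicator_def)
    qed (use Q_consistent[OF D B(1)] A D B(2) in auto)
    also have "\<dots> = (\<integral>\<omega>. indicator B (\<Theta> \<omega>) * g (\<Theta> \<omega>) \<partial>M)"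
    proof (subst integral_law_pos)
      have "(\<lambda>\<theta>. indicator B \<theta> * g \<theta>) \<in> borel_measurable borel" using B by measurable
      then show "(\<lambda>\<theta>. indicator {0<..} \<theta> * (indicator B \<theta> * measure (Q \<theta>) D)) \<in> borel_measurable borel"
        by (simp add: g_def mult.left_commute)
    qed (simp add: g_def mult.left_commute)
    also have "\<dots> = (\<integral>\<omega>\<in>A. g (\<Theta> \<omega>) \<partial>M)"
      unfolding set_lebesgue_integral_def B(2)
      by (intro Bochner_Integration.integral_cong) (auto simp: indicator_def)
    finally show "(\<integral>\<omega>\<in>A. indicat_real D \<omega> \<partial>M) = (\<integral>\<omega>\<in>A. g (\<Theta> \<omega>) \<partial>M)" .
  next
    show "integrable M (\<lambda>\<omega>. g (\<Theta> \<omega>))"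
      using g_bounded by (intro integrable_const_bound[of _ 1]) auto
    show "(\<lambda>\<omega>. g (\<Theta> \<omega>)) \<in> borel_measurable \<F>"
      by (rule measurable_compose[OF measurable_Theta_gen g])
  qed (use D in \<open>simp add: integrable_indicator_iff emeasure_eq_measure\<close>)
  with AE_Theta_pos show ?thesis
    by eventually_elim (simp add: g_def)
qed

text \<open>The route from \<open>M\<close> to almost every \<open>Q \<theta>\<close>. Both sides
  are Borel after truncation to the positive half-line, so the set where they agree is Borel and
  \<open>AE_law_posI\<close> applies.\<close>

lemma AE_cprob_eq_imp_AE_Q_eq:
  fixes h :: "real \<Rightarrow> real"
  assumes D: "D \<in> sets M" and h: "(\<lambda>\<theta>. indicator {0<..} \<theta> * h \<theta>) \<in> borel_measurable borel"
    and "AE \<omega> in M. cprob M \<F> D \<omega> = h (\<Theta> \<omega>)"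
  shows "AE \<theta> in \<mu>. measure (Q \<theta>) D = h \<theta>"
proof (rule AE_law_posI)
  have "{\<theta>. indicator {0<..} \<theta> * measure (Q \<theta>) D = indicator {0<..} \<theta> * h \<theta>} \<in> sets borel"
    using measurable_indicator_Q[OF D] h by measurable
  moreover have "{\<theta>. indicator {0<..} \<theta> * measure (Q \<theta>) D = indicator {0<..} \<theta> * h \<theta>} =
    {\<theta>. 0 < \<theta> \<longrightarrow> measure (Q \<theta>) D = h \<theta>}"
    by (auto simp: indicator_def)
  ultimately show "{\<theta>. 0 < \<theta> \<longrightarrow> measure (Q \<theta>) D = h \<theta>} \<in> sets borel" by simp
  show "AE \<omega> in M. measure (Q (\<Theta> \<omega>)) D = h (\<Theta> \<omega>)"
    using cprob_eq_Q[OF D] assms(3) by eventually_elim simp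
qed

text \<open>Over every event of the sigma-algebra of \<Theta>, the constant \<open>prob D\<close>
  has the same integral as the indicator of \<open>D\<close>, by the product formula.\<close>

lemma cprob_indep:
  assumes "indep_set (sets \<F>) (sets G)" "D \<in> sets G"
  shows "AE \<omega> in M. cprob M \<F> D \<omega> = prob D"
  unfolding cprob_def
proof (rule cond.real_cond_exp_charact)
  have D: "D \<in> sets M" using assms indep_setD_ev2 by blast
  then show "integrable M (indicator D :: 'a \<Rightarrow> real)"
    by (simp add: integrable_indicator_iff emeasure_eq_measure)
  fix A assume A: "A \<in> sets \<F>"
  then have A': "A \<in> sets M" using assms(1) indep_setD_ev1 by blast
  have "(\<integral>\<omega>\<in>A. indicat_real D \<omega> \<partial>M) = (\<integral>\<omega>. indicat_real (A \<inter> D) \<omega> \<partial>M)"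
    unfolding set_lebesgue_integral_def
    by (intro Bochner_Integration.integral_cong) (auto simp: indicator_def)
  also have "\<dots> = prob (A \<inter> D)" using A' D by simp
  also have "\<dots> = prob A * prob D"
    using assms A by (intro indep_setD)
  also have "\<dots> = (\<integral>\<omega>\<in>A. prob D \<partial>M)"
    unfolding set_lebesgue_integral_def using A' by simp
  finally show "(\<integral>\<omega>\<in>A. indicat_real D \<omega> \<partial>M) = (\<integral>\<omega>\<in>A. prob D \<partial>M)" .
qed auto

end

section \<open>Poisson processes\<close>

text \<open>With finite \<open>I\<close> and countable values the joint law lives on a countable
  space and is determined by its points. The hypothesis identifies it with the product of the
  \<open>p i\<close>, from which marginals and independence are read off.\<close>

lemma (in prob_space)
  fixes Y :: "'i \<Rightarrow> 'a \<Rightarrow> 'b::countable" and p :: "'i \<Rightarrow> 'b pmf"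
  assumes I: "finite I" "I \<noteq> {}"
    and Y: "\<And>i. i \<in> I \<Longrightarrow> Y i \<in> M \<rightarrow>\<^sub>M count_space UNIV"
    and joint: "\<And>k. prob {\<omega>\<in>space M. \<forall>i\<in>I. Y i \<omega> = k i} = (\<Prod>i\<in>I. pmf (p i) (k i))"
  shows distr_eq_pmf_of_joint: "i \<in> I \<Longrightarrow> distr M (count_space UNIV) (Y i) = measure_pmf (p i)"
    and indep_vars_of_joint: "indep_vars (\<lambda>_. count_space UNIV) Y I"
proof -
  let ?Y = "\<lambda>\<omega>. \<lambda>i\<in>I. Y i \<omega>"
  let ?P = "PiM I (\<lambda>_. count_space UNIV :: 'b measure)"
  interpret PP: product_prob_space "\<lambda>i. measure_pmf (p i)" I ..
  have Ym: "?Y \<in> M \<rightarrow>\<^sub>M ?P" using Y by (intro measurable_restrict) auto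
  have eq: "distr M ?P ?Y = PiM I (\<lambda>i. measure_pmf (p i))"
  proof (rule measure_eqI_countable'[where A = "PiE I (\<lambda>_. UNIV)"])
    fix f :: "'i \<Rightarrow> 'b" assume f: "f \<in> PiE I (\<lambda>_. UNIV)"
    have sing: "{f} = PiE I (\<lambda>i. {f i})" using f PiE_singleton[of f I] by (simp add: PiE_iff)
    show f1: "{f} \<in> sets (distr M ?P ?Y)"
      unfolding sing using I by (simp add: sets_PiM_I_finite)
    show "{f} \<in> sets (PiM I (\<lambda>i. measure_pmf (p i)))"
      unfolding sing using I by (intro sets_PiM_I_finite) auto
    have "emeasure (distr M ?P ?Y) {f} = emeasure M {\<omega>\<in>space M. \<forall>i\<in>I. Y i \<omega> = f i}"
    proof -
      have "?Y -` {f} \<inter> space M = {\<omega>\<in>space M. \<forall>i\<in>I. Y i \<omega> = f i}"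
        using f by (auto simp: PiE_iff fun_eq_iff extensional_def restrict_def)
      then show ?thesis using f1 by (simp add: emeasure_distr[OF Ym])
    qed
    also have "\<dots> = (\<Prod>i\<in>I. emeasure (measure_pmf (p i)) {f i})"
      by (simp only: emeasure_eq_measure joint emeasure_pmf_single prod_ennreal pmf_nonneg)
    also have "\<dots> = emeasure (PiM I (\<lambda>i. measure_pmf (p i))) {f}"
      unfolding sing using I by (subst PP.emeasure_PiM) auto
    finally show "emeasure (distr M ?P ?Y) {f} = emeasure (PiM I (\<lambda>i. measure_pmf (p i))) {f}" .
  qed (use I in \<open>auto simp: space_PiM intro!: countable_PiE\<close>)
  have marginal: "distr M (count_space UNIV) (Y i) = measure_pmf (p i)" if i: "i \<in> I" for i
  proof -
    have "distr M (count_space UNIV) (Y i) = distr (distr M ?P ?Y) (count_space UNIV) (\<lambda>f. f i)"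
      using i Ym by (subst distr_distr) (auto simp: comp_def)
    also have "\<dots> = distr (PiM I (\<lambda>i. measure_pmf (p i))) (measure_pmf (p i)) (\<lambda>f. f i)"
      unfolding eq by (rule distr_cong) auto
    also have "\<dots> = measure_pmf (p i)"
      using i by (rule PP.PiM_component)
    finally show ?thesis .
  qed
  then show "i \<in> I \<Longrightarrow> distr M (count_space UNIV) (Y i) = measure_pmf (p i)" .
  show "indep_vars (\<lambda>_. count_space UNIV) Y I"
    using I Y by (subst indep_vars_iff_distr_eq_PiM') (auto simp: eq marginal intro!: PiM_cong)
qed

text \<open>Equal to \<open>pmf (poisson_pmf r) k\<close> for \<open>r > 0\<close>. The explicit
  formula makes sense for all real \<open>r\<close> and is visibly continuous and Borel in
  \<open>r\<close>.\<close>

definition poisson_density :: "real \<Rightarrow> nat \<Rightarrow> real" where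
  "poisson_density r k = r ^ k / fact k * exp (- r)"

text \<open>Only the times with index at most \<open>n\<close> and the values with index below
  \<open>n\<close> enter, so rational instances can be encoded by finite lists.\<close>

definition increment_event ::
    "'a measure \<Rightarrow> (real \<Rightarrow> 'a \<Rightarrow> nat) \<Rightarrow> nat \<Rightarrow> (nat \<Rightarrow> real) \<Rightarrow> (nat \<Rightarrow> nat) \<Rightarrow> 'a set" where
  "increment_event M N n t k = {\<omega>\<in>space M. \<forall>i<n. N (t (Suc i)) \<omega> - N (t i) \<omega> = k i}"

lemma increment_nonneg:
  fixes t :: "nat \<Rightarrow> real"
  assumes "0 \<le> t 0" "\<forall>i<n. t i < t (Suc i)" "i \<le> n"
  shows "0 \<le> t i"
  using assms(3)
proof (induction i)
  case (Suc i)
  then have "0 \<le> t i" "t i < t (Suc i)" using assms(2) by auto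
  then show ?case by linarith
qed (use assms(1) in simp)

lemma measurable_increment:
  assumes "counting_process M N" "0 \<le> s" "0 \<le> t"
  shows "(\<lambda>\<omega>. N t \<omega> - N s \<omega>) \<in> M \<rightarrow>\<^sub>M count_space UNIV"
proof -
  have "N t \<in> M \<rightarrow>\<^sub>M count_space UNIV" "N s \<in> M \<rightarrow>\<^sub>M count_space UNIV"
    using assms by (auto simp: counting_process_def)
  then show ?thesis
    by (intro measurable_compose_countable[where g = "N s" and f = "\<lambda>m \<omega>. N t \<omega> - m"]
        measurable_compose[OF _ measurable_count_space, of "N t"]) auto
qed

lemma increment_event_in_sets:
  assumes "counting_process M N" "0 \<le> t 0" "\<forall>i<n. t i < t (Suc i)"
  shows "increment_event M N n t k \<in> sets M"
proof -
  have "{\<omega>\<in>space M. \<forall>i\<in>{..<n}. N (t (Suc i)) \<omega> - N (t i) \<omega> = k i} \<in> sets M"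
  proof (rule sets.sets_Collect_finite_All)
    fix i assume "i \<in> {..<n}"
    then have "(\<lambda>\<omega>. N (t (Suc i)) \<omega> - N (t i) \<omega>) \<in> M \<rightarrow>\<^sub>M count_space UNIV"
      using assms increment_nonneg[OF assms(2,3)] by (intro measurable_increment) auto
    from measurable_sets[OF this, of "{k i}"]
    have "(\<lambda>\<omega>. N (t (Suc i)) \<omega> - N (t i) \<omega>) -` {k i} \<inter> space M \<in> sets M" by simp
    also have "(\<lambda>\<omega>. N (t (Suc i)) \<omega> - N (t i) \<omega>) -` {k i} \<inter> space M =
      {\<omega>\<in>space M. N (t (Suc i)) \<omega> - N (t i) \<omega> = k i}" by auto
    finally show "{\<omega>\<in>space M. N (t (Suc i)) \<omega> - N (t i) \<omega> = k i} \<in> sets M" .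
  qed simp
  also have "{\<omega>\<in>space M. \<forall>i\<in>{..<n}. N (t (Suc i)) \<omega> - N (t i) \<omega> = k i} = increment_event M N n t k"
    by (auto simp: increment_event_def)
  finally show ?thesis .
qed

text \<open>Rational times decreasing to the given ones eventually see the same path values, so the
  indicators converge pointwise and the probabilities converge by dominated convergence. The Poisson
  product is continuous in the times, and limits are unique.\<close>

lemma (in prob_space) prob_increment_event_of_rat:
  assumes N: "counting_process M N"
    and rat: "\<And>(q :: nat \<Rightarrow> rat). 0 \<le> q 0 \<Longrightarrow> \<forall>i<n. q i < q (Suc i) \<Longrightarrow>
      prob (increment_event M N n (\<lambda>i. of_rat (q i)) k) =
      (\<Prod>i<n. poisson_density ((of_rat (q (Suc i)) - of_rat (q i)) * r) (k i))"
    and t: "0 \<le> t 0" "\<forall>i<n. t i < t (Suc i)"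
  shows "prob (increment_event M N n t k) = (\<Prod>i<n. poisson_density ((t (Suc i) - t i) * r) (k i))"
proof -
  \<comment> \<open>The approximation is strictly from the right, the side on which paths are
    locally constant.\<close>
  have "\<exists>q. t i < real_of_rat q \<and> real_of_rat q < t i + 1 / real (Suc m)" for i m
    using of_rat_dense[of "t i" "t i + 1 / real (Suc m)"] by auto
  then obtain q where q: "\<And>i m. t i < real_of_rat (q i m)"
    "\<And>i m. real_of_rat (q i m) < t i + 1 / real (Suc m)" by metis
  let ?q = "\<lambda>m i. real_of_rat (q i m)"
  have lim: "(\<lambda>m. ?q m i) \<longlonglongrightarrow> t i" for i
  proof (rule tendsto_sandwich)
    show "(\<lambda>m. t i) \<longlonglongrightarrow> t i" by simp
    show "(\<lambda>m. t i + 1 / real (Suc m)) \<longlonglongrightarrow> t i"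
      using tendsto_add[OF tendsto_const LIMSEQ_Suc[OF lim_1_over_n], of "t i"] by simp
  qed (use q in \<open>auto intro!: always_eventually less_imp_le\<close>)
  have right: "filterlim (\<lambda>m. ?q m i) (at_right (t i)) sequentially" for i
    unfolding filterlim_at using lim q(1) less_imp_neq[OF q(1), symmetric]
    by (auto intro!: always_eventually)
  \<comment> \<open>The approximating times are chosen independently for each index, so they inherit
    the strict order only for large \<open>m\<close>.\<close>
  have "\<forall>\<^sub>F m in sequentially. \<forall>i\<in>{..<n}. q i m < q (Suc i) m"
  proof (intro eventually_ball_finite ballI)
    fix i assume "i \<in> {..<n}"
    then have "t i < t (Suc i)" using t by simp
    then have "\<forall>\<^sub>F m in sequentially. ?q m i < t (Suc i)"
      by (rule order_tendstoD[OF lim])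
    then show "\<forall>\<^sub>F m in sequentially. q i m < q (Suc i) m"
    proof eventually_elim
      case (elim m)
      from less_trans[OF this q(1)] show ?case by (simp add: of_rat_less)
    qed
  qed simp
  then have ordered: "\<forall>\<^sub>F m in sequentially. \<forall>i<n. q i m < q (Suc i) m"
    by eventually_elim auto
  have q0: "0 \<le> q 0 m" for m
    using less_imp_le[OF le_less_trans[OF t(1) q(1)]] by simp
  let ?E = "\<lambda>m. increment_event M N n (?q m) k"
  have "(\<lambda>m. prob (?E m)) \<longlonglongrightarrow> prob (increment_event M N n t k)"
  proof -
    have E: "\<forall>\<^sub>F m in sequentially. ?E m \<in> sets M"
      using ordered by eventually_elim
        (use q0 in \<open>auto intro!: increment_event_in_sets[OF N] simp: of_rat_less\<close>)
    \<comment> \<open>Measurability of the approximating events is known only for ordered times; the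
      shift by \<open>m0\<close> discards the others before dominated convergence is
      applied.\<close>
    then obtain m0 where m0: "\<And>m. m \<ge> m0 \<Longrightarrow> ?E m \<in> sets M"
      by (auto simp: eventually_sequentially)
    have "(\<lambda>m. \<integral>\<omega>. indicat_real (?E (m + m0)) \<omega> \<partial>M) \<longlonglongrightarrow>
      (\<integral>\<omega>. indicat_real (increment_event M N n t k) \<omega> \<partial>M)"
    proof (rule integral_dominated_convergence[where w = "\<lambda>_. 1"])
      show "AE \<omega> in M. (\<lambda>m. indicat_real (?E (m + m0)) \<omega>) \<longlonglongrightarrow>
        indicat_real (increment_event M N n t k) \<omega>"
      proof (rule AE_I2)
        fix \<omega> assume \<omega>: "\<omega> \<in> space M"
        have "\<forall>\<^sub>F m in sequentially. \<forall>i\<in>{..n}. N (?q m i) \<omega> = N (t i) \<omega>"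
        proof (intro eventually_ball_finite ballI)
          fix i assume "i \<in> {..n}"
          then have "0 \<le> t i" using increment_nonneg[OF t] by simp
          from eventually_compose_filterlim[OF counting_process_eventually_eq[OF N \<omega> this] right]
          show "\<forall>\<^sub>F m in sequentially. N (?q m i) \<omega> = N (t i) \<omega>" .
        qed simp
        then have "\<forall>\<^sub>F m in sequentially.
          indicat_real (?E m) \<omega> = indicat_real (increment_event M N n t k) \<omega>"
          by eventually_elim (auto simp: increment_event_def indicator_def)
        from tendsto_eventually[OF this]
        show "(\<lambda>m. indicat_real (?E (m + m0)) \<omega>) \<longlonglongrightarrow> indicat_real (increment_event M N n t k) \<omega>"
          by (rule LIMSEQ_ignore_initial_segment)
      qed
    qed (use m0 increment_event_in_sets[OF N t] in \<open>auto simp: indicator_def intro!: borel_measurable_indicator'\<close>)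
    then have "(\<lambda>m. prob (?E (m + m0))) \<longlonglongrightarrow> prob (increment_event M N n t k)"
      using m0 increment_event_in_sets[OF N t] by simp
    then show ?thesis by (rule LIMSEQ_offset)
  qed
  moreover have "(\<lambda>m. prob (?E m)) \<longlonglongrightarrow> (\<Prod>i<n. poisson_density ((t (Suc i) - t i) * r) (k i))"
  proof (rule Lim_transform_eventually)
    show "(\<lambda>m. \<Prod>i<n. poisson_density ((?q m (Suc i) - ?q m i) * r) (k i)) \<longlonglongrightarrow>
      (\<Prod>i<n. poisson_density ((t (Suc i) - t i) * r) (k i))"
      unfolding poisson_density_def by (intro tendsto_intros lim) auto
    show "\<forall>\<^sub>F m in sequentially.
      (\<Prod>i<n. poisson_density ((?q m (Suc i) - ?q m i) * r) (k i)) = prob (?E m)"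
      using ordered by eventually_elim (simp add: rat[of "\<lambda>i. q i _", OF q0])
  qed
  ultimately show ?thesis by (rule LIMSEQ_unique)
qed

text \<open>The joint point probabilities along a partition give independence; a partition with one
  cell gives the law of one increment. That law depends on the length of the interval only, which is
  stationarity.\<close>

lemma (in prob_space) poisson_processI:
  assumes N: "counting_process M N" and r: "0 < r"
    and rat: "\<And>n (q :: nat \<Rightarrow> rat) k. 0 \<le> q 0 \<Longrightarrow> \<forall>i<n. q i < q (Suc i) \<Longrightarrow>
      prob (increment_event M N n (\<lambda>i. of_rat (q i)) k) =
      (\<Prod>i<n. poisson_density ((of_rat (q (Suc i)) - of_rat (q i)) * r) (k i))"
  shows "poisson_process M r N"
proof -
  let ?I = "\<lambda>t i \<omega>. N (t (Suc i)) \<omega> - N (t i) \<omega>"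
  let ?p = "\<lambda>t i. poisson_pmf ((t (Suc i) - t i) * r)"
  have joint: "prob {\<omega>\<in>space M. \<forall>i\<in>{..<n}. ?I t i \<omega> = k i} = (\<Prod>i<n. pmf (?p t i) (k i))"
    if "0 \<le> t 0" "\<forall>i<n. t i < t (Suc i)" for n t k
  proof -
    have "prob {\<omega>\<in>space M. \<forall>i\<in>{..<n}. ?I t i \<omega> = k i} = prob (increment_event M N n t k)"
      by (intro arg_cong[of _ _ prob]) (auto simp: increment_event_def)
    also have "\<dots> = (\<Prod>i<n. poisson_density ((t (Suc i) - t i) * r) (k i))"
      using N rat that by (rule prob_increment_event_of_rat)
    also have "\<dots> = (\<Prod>i<n. pmf (?p t i) (k i))"
      using that r by (intro prod.cong) (simp_all add: poisson_density_def)
    finally show ?thesis .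
  qed
  have meas: "?I t i \<in> M \<rightarrow>\<^sub>M count_space UNIV"
    if "0 \<le> t 0" "\<forall>i<n. t i < t (Suc i)" "i \<in> {..<n}" for n t i
    using that increment_nonneg[OF that(1,2)] by (intro measurable_increment[OF N]) auto
  have indep: "indep_vars (\<lambda>_. count_space UNIV) (?I t) {..<n}"
    if "0 \<le> t 0" "\<forall>i<n. t i < t (Suc i)" for n t
  proof (cases "n = 0")
    case False
    then show ?thesis
      using indep_vars_of_joint[OF _ _ meas[OF that] joint[OF that]]
      by (simp add: lessThan_empty_iff)
  next
    case True
    then show ?thesis by (simp add: indep_vars_def indep_sets_def)
  qed
  have law: "distr M (count_space UNIV) (\<lambda>\<omega>. N t \<omega> - N s \<omega>) = measure_pmf (poisson_pmf ((t - s) * r))"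
    if "0 \<le> s" "s < t" for s t
  proof -
    \<comment> \<open>Only the cell from \<open>s\<close> to \<open>t\<close> counts: the order is
      required for \<open>i < 1\<close>.\<close>
    let ?t = "\<lambda>i::nat. if i = 0 then s else t"
    have t: "0 \<le> ?t 0" "\<forall>i<1. ?t i < ?t (Suc i)" using that by auto
    from distr_eq_pmf_of_joint[OF _ _ meas[OF t] joint[OF t], of 0] show ?thesis
      by (simp add: lessThan_empty_iff)
  qed
  \<comment> \<open>For \<open>s = t\<close> both increments vanish identically; this case is
    outside the range of \<open>law\<close>.\<close>
  have "distr M (count_space UNIV) (\<lambda>\<omega>. N (t + h) \<omega> - N (s + h) \<omega>) =
      distr M (count_space UNIV) (\<lambda>\<omega>. N t \<omega> - N s \<omega>)" if "0 \<le> s" "s \<le> t" "0 \<le> h" for s t h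
    using that law[of s t] law[of "s + h" "t + h"] by (cases "s = t") auto
  moreover have "distr M (count_space UNIV) (N t) = measure_pmf (poisson_pmf (t * r))" if "0 < t" for t
  proof -
    have "distr M (count_space UNIV) (N t) = distr M (count_space UNIV) (\<lambda>\<omega>. N t \<omega> - N 0 \<omega>)"
      using N by (intro distr_cong) (auto simp: counting_process_def)
    then show ?thesis using law[of 0 t] that by simp
  qed
  ultimately show ?thesis
    unfolding poisson_process_def using N indep by blast
qed

section \<open>Transfer of laws between probability measures\<close>

text \<open>Dynkin's argument: the sets on which two probability measures agree are closed under
  complements and disjoint unions, and the cylinders form an intersection-stable generator.\<close>

lemma measure_eq_process_algebra:
  assumes "prob_space R" "prob_space R'" "sets R = sets R'"
    and Y: "\<And>i. i \<in> I \<Longrightarrow> Y i \<in> borel_measurable R"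
    and eq: "\<And>ps. ps \<in> lists (I \<times> UNIV) \<Longrightarrow> measure R (cylinder R Y ps) = measure R' (cylinder R Y ps)"
    and D: "D \<in> sets (process_algebra R I borel Y)"
  shows "measure R D = measure R' D"
proof -
  interpret R: prob_space R by fact
  interpret R': prob_space R' by fact
  have space: "space R' = space R" using sets_eq_imp_space_eq[OF assms(3)] by simp
  let ?C = "cylinder R Y ` lists (I \<times> UNIV)"
  have C: "?C \<subseteq> Pow (space R)" using cylinder_subset[of R Y] by auto
  have in_sets: "A \<in> sets R" if "A \<in> sigma_sets (space R) ?C" for A
    using that sets_process_algebra_subset[of I Y R borel R] Y
    by (auto simp: sets_process_algebra_cylinder)
  have "D \<in> sigma_sets (space R) ?C" using D by (simp add: sets_process_algebra_cylinder)
  then show ?thesis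
  proof (induction D rule: sigma_sets_induct_disjoint[OF Int_stable_cylinder C,
        consumes 1, case_names basic empty compl union])
    case (basic A)
    then show ?case using eq by blast
  next
    case (compl A)
    then show ?case
      using R.prob_compl[of A] R'.prob_compl[of A] in_sets[of A] assms(3) space by simp
  next
    case (union A)
    have R: "range A \<subseteq> sets R" using union in_sets by auto
    have "(\<lambda>i. measure R (A i)) sums measure R (\<Union>i. A i)"
      using R union by (intro R.finite_measure_UNION) auto
    moreover have "(\<lambda>i. measure R' (A i)) sums measure R' (\<Union>i. A i)"
      using R union assms(3) by (intro R'.finite_measure_UNION) auto
    ultimately show ?case using union.IH by (simp add: sums_unique2)
  qed simp
qed

text \<open>Being i.i.d. is expressed entirely by probabilities of events in the sigma-algebra of
  \<open>X\<close>, and there \<open>R\<close> and \<open>R'\<close> agree.\<close>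

lemma iid_process_transfer:
  assumes "prob_space R" "prob_space R'" "sets R = sets R'" "size_process R X"
    and eq: "\<And>D. D \<in> sets (process_algebra R {1..} borel X) \<Longrightarrow> measure R D = measure R' D"
    and iid: "iid_process R X"
  shows "iid_process R' X"
proof -
  interpret R: prob_space R by fact
  interpret R': prob_space R' by fact
  have space: "space R' = space R" using sets_eq_imp_space_eq[OF assms(3)] by simp
  let ?G = "process_algebra R {1..} borel X"
  have X: "X i \<in> borel_measurable R" "X i \<in> borel_measurable R'" if "i \<ge> 1" for i
    using that assms(4) size_process_cong[OF assms(3)] by (auto simp: size_process_def)
  have XG: "X i \<in> borel_measurable ?G" if "i \<ge> 1" for i
    using that by (intro measurable_process_algebra) auto
  have "distr R borel (X n) = distr R' borel (X n)" if "n \<ge> 1" for n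
  proof (rule measure_eqI)
    fix A assume A: "A \<in> sets (distr R borel (X n))"
    then have "X n -` A \<inter> space R \<in> sets ?G"
      using measurable_sets[OF XG[OF that]] by simp
    then show "emeasure (distr R borel (X n)) A = emeasure (distr R' borel (X n)) A"
      using A X[OF that] eq
      by (simp add: emeasure_distr R.emeasure_eq_measure R'.emeasure_eq_measure space)
  qed simp
  moreover have "R'.indep_vars (\<lambda>_. borel) X {1..}"
    unfolding R'.indep_vars_def2
  proof (intro conjI ballI R'.indep_setsI)
    fix A J
    assume J: "J \<noteq> {}" "J \<subseteq> {1..}" "finite J"
      and A: "\<forall>j\<in>J. A j \<in> {X j -` B \<inter> space R' |B. B \<in> sets borel}"
    have R: "R.indep_sets (\<lambda>i. {X i -` B \<inter> space R |B. B \<in> sets borel}) {1..}"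
      using iid by (simp add: iid_process_def R.indep_vars_def2)
    have AG: "A j \<in> sets ?G" if j: "j \<in> J" for j
    proof -
      obtain B where "B \<in> sets borel" "A j = X j -` B \<inter> space R"
        using bspec[OF A j] by (auto simp: space)
      then show ?thesis using measurable_sets[OF XG, of j B] j J(2) by auto
    qed
    have "measure R (\<Inter>j\<in>J. A j) = (\<Prod>j\<in>J. measure R (A j))"
      using A J by (intro R.indep_setsD[OF R]) (auto simp: space)
    moreover have "(\<Inter>j\<in>J. A j) \<in> sets ?G"
      using AG J by (intro sets.finite_INT) auto
    ultimately show "measure R' (\<Inter>j\<in>J. A j) = (\<Prod>j\<in>J. measure R' (A j))"
      using AG by (simp add: eq)
  qed (use X in \<open>auto intro: measurable_sets\<close>)
  moreover have "distr R borel (X n) = distr R borel (X 1)" if "n \<ge> 1" for n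
    using iid that unfolding iid_process_def by blast
  ultimately show ?thesis
    unfolding iid_process_def by (metis order_refl)
qed

lemma
  assumes "cond_indep_set M F A B"
  shows cond_indep_setD: "\<And>a b. a \<in> A \<Longrightarrow> b \<in> B \<Longrightarrow>
      AE \<omega> in M. cprob M F (a \<inter> b) \<omega> = cprob M F a \<omega> * cprob M F b \<omega>"
    and cond_indep_setD_ev1: "A \<subseteq> sets M"
proof -
  have "\<forall>i\<in>UNIV. case_bool A B i \<subseteq> sets M"
    using assms unfolding cond_indep_set_def cond_indep_sets_def by (rule conjunct1)
  from bspec[OF this, of True] show "A \<subseteq> sets M" by simp
  have *: "\<forall>J\<subseteq>UNIV. J \<noteq> {} \<longrightarrow> finite J \<longrightarrow> (\<forall>C\<in>Pi J (case_bool A B).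
      AE \<omega> in M. cprob M F (\<Inter>j\<in>J. C j) \<omega> = (\<Prod>j\<in>J. cprob M F (C j) \<omega>))"
    using assms unfolding cond_indep_set_def cond_indep_sets_def by (rule conjunct2)
  fix a b assume "a \<in> A" "b \<in> B"
  then have "case_bool a b \<in> Pi UNIV (case_bool A B)"
    by (auto split: bool.split)
  from *[rule_format, OF _ _ _ this]
  show "AE \<omega> in M. cprob M F (a \<inter> b) \<omega> = cprob M F a \<omega> * cprob M F b \<omega>"
    by (simp add: UNIV_bool Int_commute mult.commute)
qed

section \<open>Mixed processes and their disintegration\<close>

text \<open>Neither side of the equivalence is assumed, so the consequences of (a1) and (a2) can be
  used in both directions.\<close>

locale mixed_setting = disintegration +
  fixes N :: "real \<Rightarrow> 'a \<Rightarrow> nat" and X :: "nat \<Rightarrow> 'a \<Rightarrow> real"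
  assumes counting: "counting_process M N" and sizes: "size_process M X"
    and cond_indep: "cond_indep_set M \<F> (sets (process_algebra M {1..} borel (interarrival N)))
      (sets (process_algebra M {1..} borel X))"
    and indep: "indep_set (sets \<F>) (sets (process_algebra M {1..} borel X))"
begin

abbreviation "\<N> \<equiv> process_algebra M {0..} (count_space UNIV) N"
abbreviation "\<W> \<equiv> process_algebra M {1..} borel (interarrival N)"
abbreviation "\<X> \<equiv> process_algebra M {1..} borel X"

lemma sets_X_subset: "sets \<X> \<subseteq> events"
  using indep indep_setD_ev2 by blast

lemma sets_W_subset: "sets \<W> \<subseteq> events"
  using cond_indep by (rule cond_indep_setD_ev1)

lemma X_measurable: "i \<ge> 1 \<Longrightarrow> X i \<in> borel_measurable M"
  using sizes by (auto simp: size_process_def)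

lemma cylinder_in_process_algebra:
  "ps \<in> lists (I \<times> UNIV) \<Longrightarrow> cylinder M Y ps \<in> sets (process_algebra M I borel Y)"
  by (auto simp: sets_process_algebra_cylinder)

lemma counting_Q: "0 < \<theta> \<Longrightarrow> counting_process (Q \<theta>) N"
  using counting counting_process_cong[OF sets_Q] by simp

lemma sizes_Q: "0 < \<theta> \<Longrightarrow> size_process (Q \<theta>) X"
  using sizes size_process_cong[OF sets_Q] by simp

lemma AE_pos: "AE \<theta> in \<mu>. 0 < \<theta>"
  by (rule AE_I2) simp

section \<open>Law of the sizes and independence under almost every conditional measure\<close>

text \<open>By (a2) the conditional probability of an event of \<X> is constant. The exceptional set
  depends on the event, so the countably many cylinders are treated first; their common null set
  then serves for all of \<X>.\<close>

lemma AE_Q_eq_prob: "AE \<theta> in \<mu>. \<forall>D\<in>sets \<X>. measure (Q \<theta>) D = prob D"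
proof -
  have "AE \<theta> in \<mu>. measure (Q \<theta>) D = prob D" if D: "D \<in> sets \<X>" for D
    using D sets_X_subset cprob_indep[OF indep D] by (intro AE_cprob_eq_imp_AE_Q_eq) auto
  then have "AE \<theta> in \<mu>. \<forall>ps\<in>lists ({1..} \<times> UNIV). measure (Q \<theta>) (cylinder M X ps) = prob (cylinder M X ps)"
    by (subst AE_ball_countable) (simp, intro ballI, simp only: cylinder_in_process_algebra)
  with AE_pos show ?thesis
  proof eventually_elim
    case (elim \<theta>)
    show ?case
    proof
      fix D assume "D \<in> sets \<X>"
      from measure_eq_process_algebra[OF prob_space_axioms prob_space_Q[OF elim(1)]
          sets_Q[OF elim(1), symmetric] X_measurable _ this]
      show "measure (Q \<theta>) D = prob D" using elim(2) by auto
    qed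
  qed
qed

text \<open>By (a1) each fixed pair of events factorises for almost every \<theta>. Pairs of
  cylinders are countable and share one null set; outside it independence extends from the
  generators to \<W> and \<X>, and then restricts to \<N>.\<close>

lemma AE_Q_indep: "AE \<theta> in \<mu>. prob_space.indep_set (Q \<theta>) (sets \<N>) (sets \<X>)"
proof -
  have prod: "AE \<theta> in \<mu>. measure (Q \<theta>) (A \<inter> B) = measure (Q \<theta>) A * measure (Q \<theta>) B"
    if A: "A \<in> sets \<W>" and B: "B \<in> sets \<X>" for A B
  proof (rule AE_cprob_eq_imp_AE_Q_eq)
    have ev: "A \<in> events" "B \<in> events" using A B sets_W_subset sets_X_subset by auto
    then show "A \<inter> B \<in> events" by simp
    \<comment> \<open>An indicator equals its own square, so each factor can carry a copy and be
      Borel by itself.\<close>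
    have "(\<lambda>\<theta>. (indicator {0<..} \<theta> * measure (Q \<theta>) A) * (indicator {0<..} \<theta> * measure (Q \<theta>) B))
        \<in> borel_measurable borel"
      using ev by (intro borel_measurable_times measurable_indicator_Q)
    then show "(\<lambda>\<theta>. indicator {0<..} \<theta> * (measure (Q \<theta>) A * measure (Q \<theta>) B)) \<in> borel_measurable borel"
      by (rule measurable_cong[THEN iffD1, rotated]) (simp add: indicator_def)
    from cond_indep_setD[OF cond_indep A B]
      cprob_eq_Q[OF ev(1)] cprob_eq_Q[OF ev(2)] cprob_eq_Q[OF \<open>A \<inter> B \<in> events\<close>]
    show "AE \<omega> in M. cprob M \<F> (A \<inter> B) \<omega> = measure (Q (\<Theta> \<omega>)) A * measure (Q (\<Theta> \<omega>)) B"
      by eventually_elim simp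
  qed
  let ?W = "cylinder M (interarrival N)" and ?X = "cylinder M X"
  let ?L = "lists ({1..} \<times> UNIV) :: (nat \<times> rat) list set"
  have "AE \<theta> in \<mu>. \<forall>ps\<in>?L. \<forall>qs\<in>?L.
      measure (Q \<theta>) (?W ps \<inter> ?X qs) = measure (Q \<theta>) (?W ps) * measure (Q \<theta>) (?X qs)"
    by (subst AE_ball_countable, simp, intro ballI, subst AE_ball_countable, simp)
      (intro ballI prod cylinder_in_process_algebra)
  with AE_pos show ?thesis
  proof eventually_elim
    case (elim \<theta>)
    interpret Q: prob_space "Q \<theta>" using elim(1) by (rule prob_space_Q)
    have "?W ` ?L \<subseteq> sets \<W>" "?X ` ?L \<subseteq> sets \<X>"
      by (intro image_subsetI cylinder_in_process_algebra; assumption)+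
    then have "?W ` ?L \<subseteq> events" "?X ` ?L \<subseteq> events"
      using sets_W_subset sets_X_subset by blast+
    then have "Q.indep_set (?W ` ?L) (?X ` ?L)"
      unfolding Q.indep_sets2_eq sets_Q[OF elim(1)] using elim(2) by blast
    then have "Q.indep_set (sets \<W>) (sets \<X>)"
      unfolding sets_process_algebra_cylinder space_Q[OF elim(1), symmetric]
      by (intro Q.indep_set_sigma_sets Int_stable_cylinder) (simp_all add: space_Q[OF elim(1)])
    then show ?case
      using sets_process_algebra_counting[OF counting] unfolding Q.indep_sets2_eq by blast
  qed
qed

text \<open>Conditional independence alone does not survive averaging. Here it does, since
  \<open>measure (Q \<theta>) B\<close> is almost everywhere the constant \<open>prob B\<close> and
  leaves the integral.\<close>

lemma indep_N_X: "indep_set (sets \<N>) (sets \<X>)"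
  unfolding indep_sets2_eq
proof (intro conjI ballI)
  show N: "sets \<N> \<subseteq> events"
    using sets_process_algebra_counting[OF counting] sets_W_subset by blast
  show "sets \<X> \<subseteq> events" by (rule sets_X_subset)
  fix A B assume A: "A \<in> sets \<N>" and B: "B \<in> sets \<X>"
  then have ev: "A \<in> events" "B \<in> events" using N sets_X_subset by auto
  have "prob (A \<inter> B) = (\<integral>\<theta>. measure (Q \<theta>) (A \<inter> B) \<partial>\<mu>)"
    using ev by (intro measure_eq_integral_Q) simp
  also have "\<dots> = (\<integral>\<theta>. measure (Q \<theta>) A * prob B \<partial>\<mu>)"
  proof (rule integral_cong_AE)
    show "AE \<theta> in \<mu>. measure (Q \<theta>) (A \<inter> B) = measure (Q \<theta>) A * prob B"
      using AE_pos AE_Q_indep AE_Q_eq_prob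
    proof eventually_elim
      case (elim \<theta>)
      from prob_space.indep_setD[OF prob_space_Q[OF elim(1)] elim(2) A B] elim(3) B
      show ?case by simp
    qed
  qed (use ev in auto)
  also have "\<dots> = prob A * prob B"
    using measure_eq_integral_Q[OF ev(1)] by simp
  finally show "prob (A \<inter> B) = prob A * prob B" .
qed

lemma AE_Q_iid_iff: "AE \<theta> in \<mu>. iid_process (Q \<theta>) X \<longleftrightarrow> iid_process M X"
  using AE_pos AE_Q_eq_prob
proof eventually_elim
  case (elim \<theta>)
  have alg: "process_algebra (Q \<theta>) {1..} borel X = \<X>"
    by (rule process_algebra_cong) (rule space_Q[OF elim(1)])
  show ?case
  proof
    show "iid_process M X" if "iid_process (Q \<theta>) X"
      using prob_space_Q[OF elim(1)] prob_space_axioms sets_Q[OF elim(1)] sizes_Q[OF elim(1)] _ that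
      by (rule iid_process_transfer) (use elim(2) alg in auto)
    show "iid_process (Q \<theta>) X" if "iid_process M X"
      using prob_space_axioms prob_space_Q[OF elim(1)] sets_Q[OF elim(1), symmetric] sizes _ that
      by (rule iid_process_transfer) (use elim(2) in auto)
  qed
qed

section \<open>The Poisson property in both directions\<close>

lemma AE_cprob_increment:
  assumes mixed: "mixed_poisson_process M \<Theta> N" and st: "0 \<le> s" "s < t"
  shows "AE \<omega> in M. cprob M \<F> {\<omega>\<in>space M. N t \<omega> - N s \<omega> = k} \<omega> =
    poisson_density ((t - s) * \<Theta> \<omega>) k"
proof -
  have "\<forall>s t h B. 0 \<le> s \<longrightarrow> s \<le> t \<longrightarrow> 0 \<le> h \<longrightarrow>
        (AE \<omega> in M. cprob M \<F> {\<omega>\<in>space M. N (t + h) \<omega> - N (s + h) \<omega> \<in> B} \<omega> =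
           cprob M \<F> {\<omega>\<in>space M. N t \<omega> - N s \<omega> \<in> B} \<omega>)"
    using mixed unfolding mixed_poisson_process_def by (elim conjE)
  \<comment> \<open>Stationarity for the interval from \<open>0\<close> to \<open>t - s\<close>,
    shifted by \<open>s\<close>; as \<open>N 0\<close> vanishes, this leaves the law of
    \<open>N (t - s)\<close>.\<close>
  from this[rule_format, of 0 "t - s" s "{k}"] st
  have "AE \<omega> in M. cprob M \<F> {\<omega>\<in>space M. N t \<omega> - N s \<omega> \<in> {k}} \<omega> =
    cprob M \<F> {\<omega>\<in>space M. N (t - s) \<omega> - N 0 \<omega> \<in> {k}} \<omega>" by simp
  also have "{\<omega>\<in>space M. N (t - s) \<omega> - N 0 \<omega> \<in> {k}} = {\<omega>\<in>space M. N (t - s) \<omega> \<in> {k}}"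
    using counting by (auto simp: counting_process_def)
  finally have stationary: "AE \<omega> in M. cprob M \<F> {\<omega>\<in>space M. N t \<omega> - N s \<omega> \<in> {k}} \<omega> =
    cprob M \<F> {\<omega>\<in>space M. N (t - s) \<omega> \<in> {k}} \<omega>" .
  have "\<forall>t>0. \<forall>B. AE \<omega> in M. cprob M \<F> {\<omega>\<in>space M. N t \<omega> \<in> B} \<omega> =
         measure_pmf.prob (poisson_pmf (t * \<Theta> \<omega>)) B"
    using mixed unfolding mixed_poisson_process_def by (elim conjE)
  from this[rule_format, of "t - s" "{k}"] st
  have "AE \<omega> in M. cprob M \<F> {\<omega>\<in>space M. N (t - s) \<omega> \<in> {k}} \<omega> =
    measure_pmf.prob (poisson_pmf ((t - s) * \<Theta> \<omega>)) {k}" by simp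
  with stationary AE_Theta_pos show ?thesis
    by eventually_elim (use st in \<open>simp add: measure_pmf_single poisson_density_def\<close>)
qed

lemma AE_Q_increment_event:
  assumes mixed: "mixed_poisson_process M \<Theta> N"
    and t: "0 \<le> t 0" "\<forall>i<n. t i < t (Suc i)"
  shows "AE \<theta> in \<mu>. measure (Q \<theta>) (increment_event M N n t k) =
    (\<Prod>i<n. poisson_density ((t (Suc i) - t i) * \<theta>) (k i))"
proof (cases "n = 0")
  \<comment> \<open>Here the event is the whole space and the product is empty. Conditional
    independence speaks of nonempty index sets only, so this case is separate.\<close>
  case True
  have "AE \<theta> in \<mu>. measure (Q \<theta>) (space M) = 1"
    using AE_pos
  proof eventually_elim
    case (elim \<theta>)
    from prob_space.prob_space[OF prob_space_Q[OF elim]] show ?case by (simp add: space_Q[OF elim])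
  qed
  then show ?thesis using True by (simp add: increment_event_def)
next
  case False
  let ?I = "\<lambda>i \<omega>. N (t (Suc i)) \<omega> - N (t i) \<omega>"
  let ?A = "\<lambda>i. {\<omega>\<in>space M. ?I i \<omega> = k i}"
  show ?thesis
  proof (rule AE_cprob_eq_imp_AE_Q_eq)
    show "increment_event M N n t k \<in> events"
      using counting t by (rule increment_event_in_sets)
    have "(\<lambda>\<theta>. \<Prod>i<n. poisson_density ((t (Suc i) - t i) * \<theta>) (k i)) \<in> borel_measurable borel"
      unfolding poisson_density_def by measurable
    then show "(\<lambda>\<theta>. indicator {0<..} \<theta> * (\<Prod>i<n. poisson_density ((t (Suc i) - t i) * \<theta>) (k i)))
        \<in> borel_measurable borel"
      by (intro borel_measurable_times borel_measurable_indicator) auto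
    have A: "?A i \<in> sets (gen_algebra M (count_space UNIV) (?I i))" for i
    proof -
      have "?A i = ?I i -` {k i} \<inter> space M" by auto
      then show ?thesis by (auto simp: sets_gen_algebra)
    qed
    have "\<forall>n (t :: nat \<Rightarrow> real). 0 \<le> t 0 \<longrightarrow> (\<forall>k<n. t k < t (Suc k)) \<longrightarrow>
        cond_indep_sets M \<F>
          (\<lambda>k. sets (gen_algebra M (count_space UNIV) (\<lambda>\<omega>. N (t (Suc k)) \<omega> - N (t k) \<omega>))) {..<n}"
      using mixed unfolding mixed_poisson_process_def by (elim conjE)
    then have "cond_indep_sets M \<F> (\<lambda>i. sets (gen_algebra M (count_space UNIV) (?I i))) {..<n}"
      using t by blast
    then have "\<forall>J\<subseteq>{..<n}. J \<noteq> {} \<longrightarrow> finite J \<longrightarrow>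
      (\<forall>A\<in>Pi J (\<lambda>i. sets (gen_algebra M (count_space UNIV) (?I i))).
        AE \<omega> in M. cprob M \<F> (\<Inter>j\<in>J. A j) \<omega> = (\<Prod>j\<in>J. cprob M \<F> (A j) \<omega>))"
      unfolding cond_indep_sets_def by (rule conjunct2)
    from this[rule_format, of "{..<n}" ?A] A False
    have "AE \<omega> in M. cprob M \<F> (\<Inter>j<n. ?A j) \<omega> = (\<Prod>j<n. cprob M \<F> (?A j) \<omega>)"
      by (auto simp: lessThan_empty_iff)
    moreover have "(\<Inter>j<n. ?A j) = increment_event M N n t k"
      using False by (auto simp: increment_event_def)
    ultimately have "AE \<omega> in M. cprob M \<F> (increment_event M N n t k) \<omega> = (\<Prod>j<n. cprob M \<F> (?A j) \<omega>)"
      by simp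
    moreover have "AE \<omega> in M. \<forall>i\<in>{..<n}. cprob M \<F> (?A i) \<omega> = poisson_density ((t (Suc i) - t i) * \<Theta> \<omega>) (k i)"
    proof (intro AE_finite_allI)
      fix i assume "i \<in> {..<n}"
      then show "AE \<omega> in M. cprob M \<F> (?A i) \<omega> = poisson_density ((t (Suc i) - t i) * \<Theta> \<omega>) (k i)"
        using t increment_nonneg[OF t] by (intro AE_cprob_increment[OF mixed]) auto
    qed simp
    ultimately show "AE \<omega> in M. cprob M \<F> (increment_event M N n t k) \<omega> =
        (\<Prod>i<n. poisson_density ((t (Suc i) - t i) * \<Theta> \<omega>) (k i))"
      by eventually_elim simp
  qed
qed

text \<open>Sequences of rational times are uncountable, but an increment event uses only finitely
  many entries. Quantifying over pairs of lists instead gives a single null set, and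
  \<open>poisson_processI\<close> supplies the real times.\<close>

lemma AE_Q_poisson:
  assumes mixed: "mixed_poisson_process M \<Theta> N"
  shows "AE \<theta> in \<mu>. poisson_process (Q \<theta>) \<theta> N"
proof -
  let ?t = "\<lambda>qs i. real_of_rat (qs ! i)"
  let ?P = "\<lambda>qs ks. 0 \<le> qs ! 0 \<and> (\<forall>i<length ks. qs ! i < qs ! Suc i)"
  let ?eq = "\<lambda>\<theta> n t k. measure (Q \<theta>) (increment_event M N n t k) =
    (\<Prod>i<n. poisson_density ((t (Suc i) - t i) * \<theta>) (k i))"
  \<comment> \<open>A list \<open>qs\<close> that is too short does no harm: an out-of-range
    \<open>qs ! i\<close> is still some rational, and \<open>?P\<close> orders it like the
    others.\<close>
  have "AE \<theta> in \<mu>. ?P qs ks \<longrightarrow> ?eq \<theta> (length ks) (?t qs) ((!) ks)" for qs ks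
  proof (cases "?P qs ks")
    case True
    then have "0 \<le> ?t qs 0" "\<forall>i<length ks. ?t qs i < ?t qs (Suc i)"
      by (auto simp: of_rat_less)
    from AE_Q_increment_event[OF mixed this] show ?thesis by simp
  next
    case False
    then show ?thesis by (intro AE_I2) blast
  qed
  then have "AE \<theta> in \<mu>. \<forall>qs ks. ?P qs ks \<longrightarrow> ?eq \<theta> (length ks) (?t qs) ((!) ks)"
    by (simp add: AE_all_countable)
  with AE_pos show ?thesis
  proof eventually_elim
    case (elim \<theta>)
    interpret Q: prob_space "Q \<theta>" using elim(1) by (rule prob_space_Q)
    show ?case
    proof (rule Q.poisson_processI[OF counting_Q[OF elim(1)] elim(1)])
      fix n and k :: "nat \<Rightarrow> nat" and q :: "nat \<Rightarrow> rat"
      assume q: "0 \<le> q 0" "\<forall>i<n. q i < q (Suc i)"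
      \<comment> \<open>There is one more time than there are increments.\<close>
      let ?qs = "map q [0..<Suc n]" and ?ks = "map k [0..<n]"
      have nth: "?qs ! i = q i" if "i \<le> n" for i
        using that by (simp del: upt_Suc add: nth_map_upt)
      have "?P ?qs ?ks" using q by (auto simp: nth simp del: upt_Suc)
      with elim(2) have "?eq \<theta> (length ?ks) (?t ?qs) ((!) ?ks)" by blast
      moreover have "increment_event M N n (?t ?qs) ((!) ?ks) = increment_event (Q \<theta>) N n (\<lambda>i. of_rat (q i)) k"
        unfolding increment_event_def space_Q[OF elim(1)]
        by (intro Collect_cong) (simp add: nth del: upt_Suc)
      moreover have "(\<Prod>i<n. poisson_density ((?t ?qs (Suc i) - ?t ?qs i) * \<theta>) (?ks ! i)) =
          (\<Prod>i<n. poisson_density ((of_rat (q (Suc i)) - of_rat (q i)) * \<theta>) (k i))"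
        by (intro prod.cong) (simp_all add: nth del: upt_Suc)
      ultimately show "Q.prob (increment_event (Q \<theta>) N n (\<lambda>i. of_rat (q i)) k) =
          (\<Prod>i<n. poisson_density ((of_rat (q (Suc i)) - of_rat (q i)) * \<theta>) (k i))"
        by simp
    qed
  qed
qed

text \<open>For almost every \<omega> the measure \<open>Q (\<Theta> \<omega>)\<close> makes
  \<open>N\<close> Poisson with rate \<open>\<Theta> \<omega>\<close>. By \<open>cprob_eq_Q\<close>
  each conditional clause is, pointwise in \<omega>, the matching clause for this measure; the null
  set may vary with the events, as the definition permits.\<close>

lemma mixed_poisson_of_AE_Q:
  assumes "AE \<theta> in \<mu>. poisson_process (Q \<theta>) \<theta> N"
  shows "mixed_poisson_process M \<Theta> N"
proof -
  have poisson: "AE \<omega> in M. 0 < \<Theta> \<omega> \<and> poisson_process (Q (\<Theta> \<omega>)) (\<Theta> \<omega>) N"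
    using AE_Theta_pos AE_law_posD[OF assms] by eventually_elim simp
  have N_meas: "N t \<in> M \<rightarrow>\<^sub>M count_space UNIV" if "0 \<le> t" for t
    using counting that by (auto simp: counting_process_def)
  have Q_distr: "measure (Q \<theta>) {\<omega>\<in>space M. Y \<omega> \<in> B} = measure (distr (Q \<theta>) (count_space UNIV) Y) B"
    if "0 < \<theta>" "Y \<in> M \<rightarrow>\<^sub>M count_space UNIV" for \<theta> and Y :: "'a \<Rightarrow> nat" and B
  proof -
    have "Y \<in> Q \<theta> \<rightarrow>\<^sub>M count_space UNIV"
      using that by (subst measurable_cong_sets[OF sets_Q refl]) auto
    then show ?thesis
      using that by (subst measure_distr) (auto simp: space_Q intro!: arg_cong[of _ _ "measure _"])
  qed
  have ev: "{\<omega>\<in>space M. Y \<omega> \<in> B} \<in> events"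
    if "Y \<in> M \<rightarrow>\<^sub>M count_space UNIV" for Y :: "'a \<Rightarrow> nat" and B
    using measurable_sets[OF that, of B] by (simp add: vimage_def Int_def conj_commute)
  have "cond_indep_sets M \<F>
      (\<lambda>k. sets (gen_algebra M (count_space UNIV) (\<lambda>\<omega>. N (t (Suc k)) \<omega> - N (t k) \<omega>))) {..<n}"
    if t: "0 \<le> t 0" "\<forall>k<n. t k < t (Suc k)" for n and t :: "nat \<Rightarrow> real"
  proof -
    let ?I = "\<lambda>i \<omega>. N (t (Suc i)) \<omega> - N (t i) \<omega>"
    let ?G = "\<lambda>i. sets (gen_algebra M (count_space UNIV) (?I i))"
    have G: "?G i \<subseteq> events" if "i \<in> {..<n}" for i
      using that increment_nonneg[OF t]
      by (intro sets_gen_algebra_subset measurable_increment[OF counting]) auto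
    have "AE \<omega> in M. cprob M \<F> (\<Inter>j\<in>J. A j) \<omega> = (\<Prod>j\<in>J. cprob M \<F> (A j) \<omega>)"
      if J: "J \<subseteq> {..<n}" "J \<noteq> {}" "finite J" and A: "A \<in> Pi J ?G" for J A
    proof -
      have A_ev: "A j \<in> events" if "j \<in> J" for j
        using G[of j] A J(1) that by (auto simp: Pi_iff)
      have all: "AE \<omega> in M. \<forall>j\<in>J. cprob M \<F> (A j) \<omega> = measure (Q (\<Theta> \<omega>)) (A j)"
        using J(3) A_ev by (intro AE_finite_allI cprob_eq_Q) auto
      have "(\<Inter>j\<in>J. A j) \<in> events" using A_ev J by (intro sets.finite_INT) auto
      from cprob_eq_Q[OF this] all poisson show ?thesis
      proof eventually_elim
        case (elim \<omega>)
        then have pos: "0 < \<Theta> \<omega>" by simp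
        interpret Q: prob_space "Q (\<Theta> \<omega>)" using pos by (rule prob_space_Q)
        have "Q.indep_vars (\<lambda>_. count_space UNIV) ?I {..<n}"
          using elim(3) t unfolding poisson_process_def by blast
        then have "Q.indep_sets ?G {..<n}"
          unfolding Q.indep_vars_def2 by (simp add: sets_gen_algebra space_Q[OF pos])
        then have "Q.prob (\<Inter>j\<in>J. A j) = (\<Prod>j\<in>J. Q.prob (A j))"
          using J A by (intro Q.indep_setsD) auto
        with elim show ?case by simp
      qed
    qed
    with G show ?thesis unfolding cond_indep_sets_def by blast
  qed
  moreover have "AE \<omega> in M. cprob M \<F> {\<omega>\<in>space M. N (t + h) \<omega> - N (s + h) \<omega> \<in> B} \<omega> =
      cprob M \<F> {\<omega>\<in>space M. N t \<omega> - N s \<omega> \<in> B} \<omega>"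
    if st: "0 \<le> s" "s \<le> t" "0 \<le> h" for s t h B
  proof -
    have I: "(\<lambda>\<omega>. N (t + h) \<omega> - N (s + h) \<omega>) \<in> M \<rightarrow>\<^sub>M count_space UNIV"
      "(\<lambda>\<omega>. N t \<omega> - N s \<omega>) \<in> M \<rightarrow>\<^sub>M count_space UNIV"
      using st by (auto intro!: measurable_increment[OF counting])
    from cprob_eq_Q[OF ev[OF I(1), of B]] cprob_eq_Q[OF ev[OF I(2), of B]] poisson show ?thesis
    proof eventually_elim
      case (elim \<omega>)
      then have "distr (Q (\<Theta> \<omega>)) (count_space UNIV) (\<lambda>\<omega>. N (t + h) \<omega> - N (s + h) \<omega>) =
          distr (Q (\<Theta> \<omega>)) (count_space UNIV) (\<lambda>\<omega>. N t \<omega> - N s \<omega>)"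
        using st unfolding poisson_process_def by blast
      with elim show ?case by (simp add: Q_distr I)
    qed
  qed
  moreover have "AE \<omega> in M. cprob M \<F> {\<omega>\<in>space M. N t \<omega> \<in> B} \<omega> =
      measure_pmf.prob (poisson_pmf (t * \<Theta> \<omega>)) B" if t: "0 < t" for t B
  proof -
    have Nt: "N t \<in> M \<rightarrow>\<^sub>M count_space UNIV" using t by (intro N_meas) simp
    from cprob_eq_Q[OF ev[OF Nt, of B]] poisson show ?thesis
    proof eventually_elim
      case (elim \<omega>)
      then have "distr (Q (\<Theta> \<omega>)) (count_space UNIV) (N t) = measure_pmf (poisson_pmf (t * \<Theta> \<omega>))"
        using t unfolding poisson_process_def by blast
      with elim show ?case by (simp add: Q_distr Nt)
    qed
  qed
  ultimately show ?thesis
    unfolding mixed_poisson_process_def using counting by blast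
qed

section \<open>The equivalence\<close>

text \<open>Path conditions and independence of \<open>N\<close> and \<open>X\<close> hold on both
  sides already, so only the i.i.d. clauses have to be matched.\<close>

lemma AE_risk_process_Q_iff: "AE \<theta> in \<mu>. risk_process (Q \<theta>) N X \<longleftrightarrow> risk_process M N X"
  using AE_pos AE_Q_indep AE_Q_iid_iff
proof eventually_elim
  case (elim \<theta>)
  have "process_algebra (Q \<theta>) {0..} (count_space UNIV) N = \<N>" "process_algebra (Q \<theta>) {1..} borel X = \<X>"
    using space_Q[OF elim(1)] by (intro process_algebra_cong; simp)+
  then show ?case
    unfolding risk_process_def
    using elim prob_space_axioms prob_space_Q counting counting_Q sizes sizes_Q indep_N_X by simp
qed

lemma CMPP_iff_AE_CPP:
  assumes S: "\<And>t \<omega>. t \<ge> 0 \<Longrightarrow> \<omega> \<in> space M \<Longrightarrow> S t \<omega> = aggregate N X t \<omega>"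
  shows "CMPP M N X S \<Theta> (distr M borel (X 1)) \<longleftrightarrow>
    (AE \<theta> in \<mu>. CPP (Q \<theta>) N X S \<theta> (distr (Q \<theta>) borel (X 1)))"
proof -
  have CPP: "AE \<theta> in \<mu>. CPP (Q \<theta>) N X S \<theta> (distr (Q \<theta>) borel (X 1)) \<longleftrightarrow>
      risk_process M N X \<and> poisson_process (Q \<theta>) \<theta> N"
    using AE_pos AE_risk_process_Q_iff
    by eventually_elim (auto simp: CPP_def S space_Q)
  have CMPP: "CMPP M N X S \<Theta> (distr M borel (X 1)) \<longleftrightarrow>
      risk_process M N X \<and> mixed_poisson_process M \<Theta> N"
    by (auto simp: CMPP_def S)
  show ?thesis
  proof
    assume "CMPP M N X S \<Theta> (distr M borel (X 1))"
    then have "risk_process M N X" "AE \<theta> in \<mu>. poisson_process (Q \<theta>) \<theta> N"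
      using CMPP AE_Q_poisson by auto
    with CPP show "AE \<theta> in \<mu>. CPP (Q \<theta>) N X S \<theta> (distr (Q \<theta>) borel (X 1))"
      by (auto elim: eventually_elim2)
  next
    assume "AE \<theta> in \<mu>. CPP (Q \<theta>) N X S \<theta> (distr (Q \<theta>) borel (X 1))"
    with CPP have *: "AE \<theta> in \<mu>. risk_process M N X \<and> poisson_process (Q \<theta>) \<theta> N"
      by eventually_elim simp
    then have "AE \<theta> in \<mu>. poisson_process (Q \<theta>) \<theta> N"
      by eventually_elim simp
    \<comment> \<open>The claim does not involve \<theta>, so a single good parameter proves
      it.\<close>
    moreover from * have "risk_process M N X"
      by (rule law_pos_ex) simp
    ultimately show "CMPP M N X S \<Theta> (distr M borel (X 1))"
      using CMPP mixed_poisson_of_AE_Q by blast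
  qed
qed

end

theorem proposition2p4:
  fixes M :: "'a measure"
    and \<Theta> :: "'a \<Rightarrow> real"
    and N :: "real \<Rightarrow> 'a \<Rightarrow> nat"
    and X :: "nat \<Rightarrow> 'a \<Rightarrow> real"
    and S :: "real \<Rightarrow> 'a \<Rightarrow> real"
    and Q :: "real \<Rightarrow> 'a measure"
  assumes M: "prob_space M"
    and Theta: "\<Theta> \<in> borel_measurable M" "emeasure M {\<omega>\<in>space M. \<Theta> \<omega> \<in> {0<..}} = 1"
    and N: "counting_process M N"
    and X: "size_process M X"
    and S: "\<And>t \<omega>. t \<ge> 0 \<Longrightarrow> \<omega> \<in> space M \<Longrightarrow> S t \<omega> = aggregate N X t \<omega>"
    and Q: "regular_cond_prob M \<Theta> Q"
    and a1: "cond_indep_set M (gen_algebra M borel \<Theta>)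
               (sets (process_algebra M {1..} borel (interarrival N)))
               (sets (process_algebra M {1..} borel X))"
    and a2: "prob_space.indep_set M (sets (gen_algebra M borel \<Theta>))
               (sets (process_algebra M {1..} borel X))"
  shows "CMPP M N X S \<Theta> (distr M borel (X 1)) \<longleftrightarrow>
    (\<exists>C\<in>null_sets (law_pos M \<Theta>). \<forall>\<theta>. \<theta> > 0 \<longrightarrow> \<theta> \<notin> C \<longrightarrow>
       CPP (Q \<theta>) N X S \<theta> (distr (Q \<theta>) borel (X 1)))"
proof -
  interpret prob_space M by (rule M)
  interpret mixed_setting M \<Theta> Q N X
    by unfold_locales (fact Theta Q N X a1 a2)+
  have "CMPP M N X S \<Theta> (distr M borel (X 1)) \<longleftrightarrow>
      (AE \<theta> in law_pos M \<Theta>. CPP (Q \<theta>) N X S \<theta> (distr (Q \<theta>) borel (X 1)))"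
    using S by (rule CMPP_iff_AE_CPP)
  \<comment> \<open>The exceptional parameters of an almost everywhere statement are covered by a
    null set \<open>C\<close>; they range over the space of the mixing law, the positive
    half-line.\<close>
  then show ?thesis
    by (auto simp: eventually_ae_filter subset_eq Bex_def)
qed

end
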